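(* Let $q$ be a prime power, let $n>1$ be an integer that is not a prime power, let $1<k<\sigma_0(n)$ (where $\sigma_0(n)$ is the number of positive divisors of $n$), and let $\mathbf{d}=(d_1,\ldots,d_k)\in\Lambda_k(n)$ be such that $\gcd(d_i,d_j)=1$ for every $1\le i<j\le k$. Let $\mathbf{a}=(a_1,\ldots,a_k)\in\mathbb{F}(\mathbf{d})$ be a $\mathbf{d}$-admissible $k$-tuple. Then there exists a primitive element $\alpha\in\mathbb{F}_{q^n}$ (a generator of $\mathbb{F}_{q^n}^*$) with $\mathrm{Tr}_{n/d_i}(\alpha)=a_i$ for all $1\le i\le k$, provided that one of the following holds: (a) $k\ge 3$; (b) $k=2$ and one of: (b.1) $d_1\ge 5$, and moreover $q\ge 5$ in case $(d_1,d_2)=(5,6)$; (b.2) $d_1=4$ and either $d_2\ge 11$, or $d_2\ge 9$ and $q\ge 3$, or $d_2\in\{5,7\}$ and $q\ge e^{e^{6.7}}$; (b.3) $d_1=3$ and either $d_2\ge 38$, or $d_2\ge 5$ and $q\ge e^{e^{26.1}}$.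
   Context: $\mathbb{F}_q$ is the finite field with $q$ elements. For a divisor $d$ of $n$ and $\alpha\in\mathbb{F}_{q^n}$, $\mathrm{Tr}_{n/d}(\alpha)=\sum_{i=0}^{n/d-1}\alpha^{q^{di}}$. $\Lambda_k(n)$ is the set of $k$-tuples $\mathbf{d}=(d_1,\ldots,d_k)$ of divisors $d_1<\cdots<d_k<n$ of $n$ such that $d_i\nmid d_j$ for all $i\ne j$. For $\mathbf{d}\in\Lambda_k(n)$, $\mathbb{F}(\mathbf{d})=\prod_{i=1}^k\mathbb{F}_{q^{d_i}}$. A tuple $\mathbf{a}=(a_1,\ldots,a_k)\in\mathbb{F}(\mathbf{d})$ is $\mathbf{d}$-admissible if $\mathrm{Tr}_{d_i/\gcd(d_i,d_j)}(a_i)=\mathrm{Tr}_{d_j/\gcd(d_i,d_j)}(a_j)$ for all $1\le i<j\le k$. *)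

theory Defs
  imports Complex_Main "HOL-Library.FuncSet" "HOL-Computational_Algebra.Computational_Algebra"
    "HOL-Number_Theory.Prime_Powers"
begin

definition is_subfield :: "'a::field set \<Rightarrow> bool" where
  "is_subfield K \<longleftrightarrow> 0 \<in> K \<and> 1 \<in> K \<and>
     (\<forall>x\<in>K. \<forall>y\<in>K. x + y \<in> K \<and> x * y \<in> K) \<and>
     (\<forall>x\<in>K. - x \<in> K \<and> inverse x \<in> K)"

text \<open>
  The ambient type plays the role of the field with \<open>q ^ n\<close> elements. Inside it, the field with
  \<open>q ^ d\<close> elements (for \<open>d\<close> a divisor of \<open>n\<close>) is the unique subfield of that cardinality; existence
  and uniqueness are proved as \<open>ex1_subfield\<close> below. Other arguments carry no meaning.
\<close>

definition GF_sub :: "nat \<Rightarrow> 'a::finite_field set" where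
  "GF_sub m = (THE K. is_subfield K \<and> card K = m)"

text \<open>
  \<open>Trace q m d\<close> is the trace from the field with \<open>q ^ m\<close> elements to the one with \<open>q ^ d\<close>
  elements; it is meaningful when \<open>d\<close> divides \<open>m\<close> and its argument lies in the former field.
\<close>

definition Trace :: "nat \<Rightarrow> nat \<Rightarrow> nat \<Rightarrow> 'a::finite_field \<Rightarrow> 'a" where
  "Trace q m d \<alpha> = (\<Sum>i<m div d. \<alpha> ^ (q ^ (d * i)))"

text \<open>A \<open>k\<close>-tuple is an extensional function on the index set \<open>{1..k}\<close>.\<close>

definition Lambda :: "nat \<Rightarrow> nat \<Rightarrow> (nat \<Rightarrow> nat) set" where
  "Lambda k n = {d \<in> {1..k} \<rightarrow>\<^sub>E {t. t dvd n}.
     strict_mono_on {1..k} d \<and> (\<forall>i\<in>{1..k}. d i < n) \<and>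
     (\<forall>i\<in>{1..k}. \<forall>j\<in>{1..k}. i \<noteq> j \<longrightarrow> \<not> d i dvd d j)}"

definition F_prod :: "nat \<Rightarrow> nat \<Rightarrow> (nat \<Rightarrow> nat) \<Rightarrow> (nat \<Rightarrow> 'a::finite_field) set" where
  "F_prod q k d = (\<Pi>\<^sub>E i\<in>{1..k}. GF_sub (q ^ d i))"

definition admissible :: "nat \<Rightarrow> nat \<Rightarrow> (nat \<Rightarrow> nat) \<Rightarrow> (nat \<Rightarrow> 'a::finite_field) \<Rightarrow> bool" where
  "admissible q k d a \<longleftrightarrow> (\<forall>i\<in>{1..k}. \<forall>j\<in>{1..k}. i < j \<longrightarrow>
     Trace q (d i) (gcd (d i) (d j)) (a i) = Trace q (d j) (gcd (d i) (d j)) (a j))"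

text \<open>
  The integer powers of a nonzero element form the cyclic subgroup it generates; zero is
  excluded automatically, since \<open>0 powi 1 = 0\<close>.
\<close>

definition primitive_element :: "'a::finite_field \<Rightarrow> bool" where
  "primitive_element \<alpha> \<longleftrightarrow> range (\<lambda>m::int. \<alpha> powi m) = UNIV - {0}"

subsection \<open>The subfield with \<open>q ^ d\<close> elements\<close>

lemma power_card_subfield:
  fixes K :: "'a::finite_field set"
  assumes K: "is_subfield K" and x: "x \<in> K"
  shows "x ^ card K = x"
proof (cases "x = 0")
  case True
  have "finite K" "K \<noteq> {}" using x by auto
  hence "card K > 0" by (simp add: card_gt_0_iff)
  thus ?thesis using True by simp
next
  case False
  let ?S = "K - {0}"
  have bij: "bij_betw (\<lambda>y. x * y) ?S ?S"
  proof (rule bij_betwI)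
    show "(\<lambda>y. x * y) \<in> ?S \<rightarrow> ?S" "(\<lambda>y. inverse x * y) \<in> ?S \<rightarrow> ?S"
      using K x False by (auto simp: is_subfield_def)
  qed (use False in auto)
  have "(\<Prod>y\<in>?S. y) = (\<Prod>y\<in>?S. x * y)"
    using prod.reindex_bij_betw[OF bij, of "\<lambda>y. y"] by simp
  also have "\<dots> = x ^ card ?S * (\<Prod>y\<in>?S. y)"
    by (simp add: prod.distrib)
  finally have "x ^ card ?S = 1" by simp
  moreover have "card K = Suc (card ?S)"
    using K by (subst card.remove[of K 0]) (auto simp: is_subfield_def)
  ultimately show ?thesis by simp
qed

lemma card_fixed_le:
  fixes m :: nat
  assumes "m > 1"
  shows "card {x::'a::finite_field. x ^ m = x} \<le> m"
proof -
  let ?p = "monom 1 m - monom 1 1 :: 'a poly"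
  have "coeff ?p m = 1" using assms by simp
  hence nz: "?p \<noteq> 0" by (metis coeff_0 zero_neq_one)
  have "degree ?p \<le> m"
    using assms by (intro degree_diff_le) (auto simp: degree_monom_eq)
  moreover have "{x. poly ?p x = 0} = {x. x ^ m = x}"
    by (auto simp: poly_monom)
  ultimately show ?thesis using card_poly_roots_bound[OF nz] by simp
qed

lemma card_roots_of_unity_ge:
  fixes r s :: nat
  assumes card: "card (UNIV :: 'a::finite_field set) = Suc (r * s)" and "r > 0" "s > 0"
  shows "card {x::'a. x ^ r = 1} \<ge> r"
proof -
  let ?q = "\<Sum>i<s. monom 1 (r * i) :: 'a poly"
  have "coeff ?q 0 = (\<Sum>i<s. if i = 0 then 1 else 0)"
    unfolding coeff_sum using \<open>r > 0\<close> by (intro sum.cong) auto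
  also have "\<dots> = 1" using \<open>s > 0\<close> by simp
  finally have nz: "?q \<noteq> 0" by (metis coeff_0 zero_neq_one)
  have "degree ?q \<le> r * (s - 1)"
    by (intro degree_sum_le) (auto simp: degree_monom_eq)
  hence q: "card {x. poly ?q x = 0} \<le> r * (s - 1)"
    using card_poly_roots_bound[OF nz] by linarith
  have "UNIV - {0} \<subseteq> {x::'a. x ^ r = 1} \<union> {x. poly ?q x = 0}"
  proof
    fix x :: 'a assume x: "x \<in> UNIV - {0}"
    have "x ^ Suc (r * s) = x"
      using finite_field_power_card_eq_same[of x] card by simp
    hence "(x ^ r) ^ s = 1" using x by (simp add: power_mult)
    hence "(x ^ r - 1) * (\<Sum>i<s. (x ^ r) ^ i) = 0"
      by (simp flip: power_diff_1_eq)
    moreover have "poly ?q x = (\<Sum>i<s. (x ^ r) ^ i)"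
      by (simp add: poly_sum poly_monom power_mult)
    ultimately show "x \<in> {x. x ^ r = 1} \<union> {x. poly ?q x = 0}" by auto
  qed
  hence "card (UNIV - {0::'a}) \<le> card ({x::'a. x ^ r = 1} \<union> {x. poly ?q x = 0})"
    by (intro card_mono) auto
  also have "\<dots> \<le> card {x::'a. x ^ r = 1} + card {x. poly ?q x = 0}"
    by (rule card_Un_le)
  finally have "r * s \<le> card {x::'a. x ^ r = 1} + r * (s - 1)"
    using card q by (simp add: card_Diff_singleton)
  thus ?thesis using \<open>s > 0\<close> by (cases s) (auto simp: algebra_simps)
qed

lemma is_subfield_fixed:
  fixes q d n :: nat
  assumes card: "card (UNIV :: 'a::finite_field set) = q ^ n" and q: "primepow q"
    and n: "n > 0" and d: "d > 0"
  shows "is_subfield {x::'a. x ^ (q ^ d) = x}"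
proof -
  from q obtain p k where p: "prime p" "k > 0" "q = p ^ k" by (auto simp: primepow_def)
  have prime: "prime CHAR('a)" by (intro prime_CHAR_semidom finite_imp_CHAR_pos finite)
  have "(\<Sum>x\<in>UNIV. x :: 'a) = (\<Sum>x\<in>UNIV. x + 1)"
    by (rule sum.reindex_bij_witness[of _ "\<lambda>x. x + 1" "\<lambda>x. x - 1"]) auto
  hence "of_nat (card (UNIV :: 'a set)) = (0 :: 'a)"
    by (simp add: sum.distrib)
  hence "CHAR('a) dvd p ^ (k * n)"
    unfolding card p(3) of_nat_eq_0_iff_char_dvd by (simp add: power_mult)
  hence "CHAR('a) = p" using prime p(1) by (metis prime_dvd_power primes_dvd_imp_eq)
  hence m: "q ^ d = CHAR('a) ^ (k * d)" using p by (simp add: power_mult)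
  have add: "(x + y) ^ (q ^ d) = x ^ (q ^ d) + y ^ (q ^ d)" for x y :: 'a
    by (rule freshmans_dream'[OF prime m])
  have pos: "q ^ d > 0" using p by (simp add: prime_gt_0_nat)
  have neg: "(- x) ^ (q ^ d) = - (x ^ (q ^ d))" for x :: 'a
    using add[of x "- x"] pos by (simp add: eq_neg_iff_add_eq_0 add.commute power_0_left split: if_splits)
  show ?thesis unfolding is_subfield_def
    using pos by (auto simp: add neg power_mult_distrib power_inverse)
qed

lemma
  fixes q d n :: nat
  assumes card: "card (UNIV :: 'a::finite_field set) = q ^ n" and q: "primepow q"
    and n: "n > 0" and d: "d dvd n"
  shows ex1_subfield: "\<exists>!K::'a set. is_subfield K \<and> card K = q ^ d"
    and GF_sub_eq: "GF_sub (q ^ d) = {x::'a. x ^ (q ^ d) = x}"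
proof -
  let ?m = "q ^ d" and ?K = "{x::'a. x ^ (q ^ d) = x}"
  have dpos: "d > 0" using n d by (auto intro!: Nat.gr0I)
  have q1: "q > 1" using primepow_gt_Suc_0[OF q] by simp
  have m1: "?m > 1" using q1 dpos by (rule one_less_power)
  obtain e where e: "n = d * e" using d by blast
  have epos: "e > 0" using n e by (auto intro!: Nat.gr0I)
  define s where "s = (\<Sum>i<e. ?m ^ i)"
  have spos: "s > 0" unfolding s_def using epos q1 by (intro sum_pos) (auto simp: lessThan_empty_iff)
  have "int (?m ^ e) - 1 = (int ?m - 1) * int s"
    using power_diff_1_eq[of "int ?m" e] by (simp add: s_def)
  hence "int (q ^ n) = int (Suc ((?m - 1) * s))"
    using m1 by (simp add: e power_mult of_nat_diff)
  hence "card (UNIV :: 'a set) = Suc ((?m - 1) * s)"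
    using card by (metis of_nat_eq_iff)
  from card_roots_of_unity_ge[OF this _ spos]
  have ge: "card {x::'a. x ^ (?m - 1) = 1} \<ge> ?m - 1" using m1 by simp
  have Km: "?K = insert 0 {x. x ^ (?m - 1) = 1}"
  proof -
    obtain t where t: "?m = Suc t" using m1 by (cases ?m) auto
    show ?thesis unfolding t by auto
  qed
  have "card ?K = Suc (card {x::'a. x ^ (?m - 1) = 1})"
    unfolding Km using m1 by (subst card_insert_disjoint) (auto simp: power_0_left)
  hence cK: "card ?K = ?m" using ge card_fixed_le[OF m1, where 'a='a] by simp
  have sub: "is_subfield ?K" by (rule is_subfield_fixed[OF card q n dpos])
  have uniq: "L = ?K" if "is_subfield L" "card L = ?m" for L :: "'a set"
  proof (rule card_subset_eq)
    show "L \<subseteq> ?K" using power_card_subfield[OF that(1)] that(2) by auto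
  qed (use that cK in auto)
  show "\<exists>!K::'a set. is_subfield K \<and> card K = q ^ d"
    using sub cK uniq by blast
  show "GF_sub (q ^ d) = ?K"
    unfolding GF_sub_def using sub cK uniq by (intro the_equality) blast+
qed

end

theory Submission
  imports Defs
begin

text \<open>
  Let \<open>\<sigma>\<close> be the \<open>q\<close>-Frobenius and \<open>\<Psi>\<^sub>i = 1 + x + \<dots> + x ^ (d i - 1)\<close>. As the \<open>d i\<close> are pairwise coprime, the
  \<open>\<Psi>\<^sub>i\<close> are pairwise comaximal in \<open>\<int>[x]\<close>, so \<open>x ^ n - 1 = G H\<close> with \<open>H = (x - 1) \<Prod>\<^sub>i \<Psi>\<^sub>i\<close> of degree
  \<open>\<lambda> = 1 + (\<Sum>i. d i - 1)\<close>. The image of \<open>G(\<sigma>)\<close> is the kernel of \<open>H(\<sigma>)\<close>, and it follows that the elements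
  with the prescribed traces contain a coset \<open>C\<close> of \<open>ker G(\<sigma>)\<close>, of size \<open>q ^ (n - \<lambda>)\<close>.

  A nontrivial multiplicative character has sum at most \<open>q ^ (n / 2)\<close> in absolute value over any coset
  of an additive subgroup. The Cohen-Huczynska sieve, applied to the prime divisors of \<open>q ^ n - 1\<close>,
  turns this into a sufficient condition for a primitive element in \<open>C\<close>: a quantity depending on
  these primes only must not exceed \<open>q ^ (n / 2 - \<lambda>)\<close>. The condition is verified by bounding the number
  and the reciprocals of the prime divisors in terms of the size of \<open>q ^ n\<close>; no factorizations
  are needed.
\<close>

subsection \<open>Characters of prime order and character sums over cosets\<close>

text \<open>What decides everything is \<open>E = n - 2 * \<lambda>\<close> compared with
  \<open>n\<close>: the sieve needs \<open>q ^ E\<close> to be large, while the primes to be sieved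
  are controlled only through the size of \<open>q ^ n\<close>. Pairwise coprime divisors have
  product at most \<open>n\<close>, so in each case the ratio \<open>E / n\<close> is worst at the
  smallest tuple with \<open>n\<close> equal to its product: 14/30 at (2,3,5), 13/35 at (5,7), 4/11
  at (4,11), 1/3 at (5,6) and (4,9), 34/114 at (3,38), 1/5 at (4,5), 1/15 at (3,5). These fractions
  are the source of nearly all constants in the numerical part.

  Down to 34/114 the condition can be met for small \<open>q\<close>, but \<open>q = 2\<close> needs
  separate care, because \<open>q ^ E\<close> may be as small as \<open>2 ^ 13\<close>. For the
  ratios 1/5 and 1/15 the estimate gains only a factor of the order of the logarithm of the prime
  cutoff, and this has to beat a multiple of \<open>n / E\<close>. The cutoff itself grows with the
  logarithm of \<open>q ^ n\<close>, whence the doubly exponential conditions on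
  \<open>q\<close>.\<close>

lemma card_power_eq_1_le:
  assumes "r > 0"
  shows "finite {x::'a::idom. x ^ r = 1}" "card {x::'a::idom. x ^ r = 1} \<le> r"
proof -
  let ?p = "monom 1 r - 1 :: 'a poly"
  have "coeff ?p r = 1" using assms by simp
  hence nz: "?p \<noteq> 0" by (metis coeff_0 zero_neq_one)
  have "degree ?p \<le> r"
    by (intro degree_diff_le) (auto simp: degree_monom_eq)
  moreover have "{x. poly ?p x = 0} = {x. x ^ r = 1}"
    by (auto simp: poly_monom)
  ultimately show "finite {x::'a. x ^ r = 1}" "card {x::'a. x ^ r = 1} \<le> r"
    using card_poly_roots_bound[OF nz] poly_roots_finite[OF nz] by auto
qed

lemma power_eq_1_coprime:
  fixes x :: "'a::monoid_mult"
  assumes "x ^ m = 1" "x ^ n = 1" "coprime m n" "m > 0"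
  shows "x = 1"
proof -
  obtain a b where ab: "a * m = b * n + 1"
  proof (cases "n = 1")
    case True
    show ?thesis using that[of 1 "m - 1"] True assms(4) by simp
  next
    case False
    show ?thesis using coprime_bezout_strong[OF assms(3) False] that by (metis mult.commute)
  qed
  have "1 = x ^ (a * m)" using assms by (metis mult.commute power_mult power_one)
  also have "\<dots> = x ^ (b * n) * x" unfolding ab by (simp only: power_add power_one_right)
  also have "x ^ (b * n) = 1" using assms by (metis mult.commute power_mult power_one)
  finally show ?thesis by simp
qed

lemma power_commuting_exponents: "((x::'a::monoid_mult) ^ m) ^ n = (x ^ n) ^ m"
  by (metis mult.commute power_mult)

lemma power_eq_1_dvd:
  fixes x :: "'a::monoid_mult"
  assumes "x ^ m = 1" "m dvd n" shows "x ^ n = 1"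
  using assms by (auto simp: power_mult)

lemma power_eq_1_gcd:
  fixes x :: "'a::field"
  assumes "x ^ m = 1" "x ^ n = 1" "m > 0"
  shows "x ^ gcd m n = 1"
proof (rule power_eq_1_coprime)
  show "(x ^ gcd m n) ^ (m div gcd m n) = 1" "(x ^ gcd m n) ^ (n div gcd m n) = 1"
    using assms by (simp_all flip: power_mult)
  show "coprime (m div gcd m n) (n div gcd m n)" using assms(3) by (intro div_gcd_coprime) auto
  show "m div gcd m n > 0" using assms(3) by (simp add: dvd_imp_le div_greater_zero_iff)
qed

lemma finite_field_power_card_minus_1:
  fixes x :: "'a::finite_field"
  assumes "x \<noteq> 0" shows "x ^ (card (UNIV :: 'a set) - 1) = 1"
proof -
  have "card (UNIV :: 'a set) \<noteq> 0" by simp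
  then obtain t where t: "card (UNIV :: 'a set) = Suc t" using not0_implies_Suc by blast
  thus ?thesis using finite_field_power_card_eq_same[of x] assms by simp
qed

text \<open>If \<open>x ^ i = 1\<close> with \<open>i\<close> not a multiple of the group order,
  then \<open>x\<close> is already killed by the gcd of both. That gcd is a proper divisor of the
  order, hence divides the order over some prime, against the hypothesis.\<close>

lemma primitive_elementI:
  fixes x :: "'a::finite_field"
  assumes "x \<noteq> 0"
    and "\<And>p. prime p \<Longrightarrow> p dvd card (UNIV :: 'a set) - 1 \<Longrightarrow> x ^ ((card (UNIV :: 'a set) - 1) div p) \<noteq> 1"
  shows "primitive_element x"
proof -
  define M where "M = card (UNIV :: 'a set) - 1"
  have "card {0, 1::'a} \<le> card (UNIV :: 'a set)" by (intro card_mono) auto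
  hence M: "M > 0" by (simp add: M_def)
  have dvd: "M dvd i" if i: "x ^ i = 1" for i
  proof (rule ccontr)
    assume ni: "\<not> M dvd i"
    define h where "h = gcd M i"
    have h: "x ^ h = 1" unfolding h_def
      using finite_field_power_card_minus_1[OF assms(1)] i M
      by (intro power_eq_1_gcd) (auto simp: M_def)
    obtain t where t: "M = h * t" unfolding h_def by (meson dvd_def gcd_dvd1)
    have "t \<noteq> 1" using t ni unfolding h_def by (metis gcd_dvd2 mult.right_neutral)
    then obtain p where p: "prime p" "p dvd t" using prime_factor_nat by blast
    then obtain u where u: "t = p * u" by blast
    have "M div p = h * u" using t u p by (simp add: prime_gt_0_nat)
    hence "x ^ (M div p) = 1" using h by (simp add: power_mult)
    moreover have "p dvd M" using t u by simp
    ultimately show False using assms(2) p(1) unfolding M_def by blast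
  qed
  have inj: "inj_on (\<lambda>i. x ^ i) {..<M}"
  proof (rule linorder_inj_onI')
    fix i j assume ij: "i \<in> {..<M}" "j \<in> {..<M}" "i < j"
    have "x ^ (j - i) \<noteq> 1"
      using dvd[of "j - i"] ij nat_dvd_not_less[of "j - i"] by auto
    moreover have "x ^ j = x ^ i * x ^ (j - i)" using ij by (simp flip: power_add)
    ultimately show "x ^ i \<noteq> x ^ j" using assms(1) by auto
  qed
  have "(\<lambda>i. x ^ i) ` {..<M} = UNIV - {0}"
  proof (rule card_subset_eq)
    show "card ((\<lambda>i. x ^ i) ` {..<M}) = card (UNIV - {0::'a})"
      using card_image[OF inj] by (simp add: M_def card_Diff_singleton)
    show "(\<lambda>i. x ^ i) ` {..<M} \<subseteq> UNIV - {0}" using assms(1) by (simp add: image_subset_iff)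
  qed simp
  moreover have "(\<lambda>i. x ^ i) ` {..<M} \<subseteq> range (\<lambda>m::int. x powi m)"
  proof
    fix y assume "y \<in> (\<lambda>i. x ^ i) ` {..<M}"
    then obtain i where "y = x powi int i" by auto
    thus "y \<in> range (\<lambda>m::int. x powi m)" by blast
  qed
  moreover have "range (\<lambda>m::int. x powi m) \<subseteq> UNIV - {0}" using assms(1) by auto
  ultimately show ?thesis unfolding primitive_element_def by (metis subset_antisym)
qed

text \<open>
  The witness maps \<open>x\<close> to the \<open>l\<close>-th power of a complex primitive \<open>p\<close>-th root of unity, where
  \<open>x ^ (M div p) = \<zeta> ^ l\<close> for a fixed \<open>p\<close>-th root of unity \<open>\<zeta> \<noteq> 1\<close> of the finite field.
\<close>

lemma ex_character_prime_order:
  fixes p :: nat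
  defines "M \<equiv> card (UNIV :: 'a::finite_field set) - 1"
  assumes p: "prime p" "p dvd M"
  obtains \<eta> :: "'a::finite_field \<Rightarrow> complex"
  where "\<And>x y. x \<noteq> (0::'a) \<Longrightarrow> y \<noteq> 0 \<Longrightarrow> \<eta> (x * y) = \<eta> x * \<eta> y"
    and "\<And>x. x \<noteq> 0 \<Longrightarrow> \<eta> x ^ p = 1"
    and "\<And>x. x \<noteq> 0 \<Longrightarrow> \<eta> x = 1 \<longleftrightarrow> x ^ (M div p) = 1"
    and "\<exists>z. z \<noteq> 0 \<and> \<eta> z \<noteq> 1"
proof -
  have "card {0, 1::'a} \<le> card (UNIV :: 'a set)" by (intro card_mono) auto
  hence M: "M > 0" by (simp add: M_def)
  have p1: "p > 1" using p(1) by (rule prime_gt_1_nat)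
  have r0: "M div p > 0" using p M by (auto simp: prime_gt_0_nat elim!: dvdE)
  have "M div p < M" using p1 M by simp
  have "\<exists>z::'a. z \<noteq> 0 \<and> z ^ (M div p) \<noteq> 1"
  proof (rule ccontr)
    assume "\<not> ?thesis"
    hence "UNIV - {0} \<subseteq> {x::'a. x ^ (M div p) = 1}" by auto
    hence "card (UNIV - {0::'a}) \<le> card {x::'a. x ^ (M div p) = 1}"
      by (intro card_mono) auto
    also have "\<dots> \<le> M div p" by (rule card_power_eq_1_le[OF r0])
    finally show False using \<open>M div p < M\<close> by (simp add: M_def card_Diff_singleton)
  qed
  then obtain z :: 'a where z: "z \<noteq> 0" "z ^ (M div p) \<noteq> 1" by blast
  define \<zeta> where "\<zeta> = z ^ (M div p)"
  have root: "(x ^ (M div p)) ^ p = 1" if "x \<noteq> 0" for x :: 'a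
    using finite_field_power_card_minus_1[OF that] p(2) by (simp add: M_def flip: power_mult)
  have \<zeta>: "\<zeta> \<noteq> 1" "\<zeta> ^ p = 1" "\<zeta> \<noteq> 0"
    using z root[of z] by (auto simp: \<zeta>_def)
  have dvd: "p dvd i" if "\<zeta> ^ i = 1" for i
  proof (rule ccontr)
    assume "\<not> p dvd i"
    hence "coprime p i" using p(1) by (simp add: prime_imp_coprime)
    thus False using power_eq_1_coprime[OF \<zeta>(2) that] p1 \<zeta>(1) by simp
  qed
  have inj: "inj_on (\<lambda>i. \<zeta> ^ i) {..<p}"
  proof (rule linorder_inj_onI')
    fix i j assume ij: "i \<in> {..<p}" "j \<in> {..<p}" "i < j"
    have "\<zeta> ^ (j - i) \<noteq> 1"
      using dvd[of "j - i"] ij nat_dvd_not_less[of "j - i"] by auto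
    moreover have "\<zeta> ^ j = \<zeta> ^ i * \<zeta> ^ (j - i)" using ij by (simp flip: power_add)
    ultimately show "\<zeta> ^ i \<noteq> \<zeta> ^ j" using \<zeta>(3) by auto
  qed
  have im: "(\<lambda>i. \<zeta> ^ i) ` {..<p} = {x. x ^ p = 1}"
  proof (rule card_seteq)
    show "(\<lambda>i. \<zeta> ^ i) ` {..<p} \<subseteq> {x. x ^ p = 1}"
      using \<zeta>(2) by (auto simp: power_commuting_exponents[of _ _ p])
    show "card {x::'a. x ^ p = 1} \<le> card ((\<lambda>i. \<zeta> ^ i) ` {..<p})"
      using card_power_eq_1_le(2)[of p, where 'a='a] p1 by (simp add: card_image[OF inj])
  qed auto
  define l where "l x = (SOME i. \<zeta> ^ i = x ^ (M div p))" for x :: 'a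
  have l: "\<zeta> ^ l x = x ^ (M div p)" if "x \<noteq> 0" for x
  proof -
    have "x ^ (M div p) \<in> (\<lambda>i. \<zeta> ^ i) ` {..<p}" unfolding im using root[OF that] by simp
    hence "\<exists>i. \<zeta> ^ i = x ^ (M div p)" by force
    thus ?thesis unfolding l_def by (rule someI_ex)
  qed
  define \<omega> where "\<omega> = cis (2 * pi / p)"
  have \<omega>p: "\<omega> ^ p = 1" using p1 by (simp add: \<omega>_def Complex.DeMoivre)
  have \<omega>1: "\<omega> \<noteq> 1"
  proof
    assume "\<omega> = 1"
    hence "cos (2 * pi / p) = 1" by (metis Re_complex_of_real cis.sel(1) of_real_1 \<omega>_def)
    then obtain k :: int where "2 * pi / p = of_int k * (2 * pi)"
      by (auto simp: cos_one_2pi_int)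
    hence "real_of_int k * real p = 1" using p1 by (simp add: field_simps)
    hence "k * int p = 1" by (metis of_int_eq_1_iff of_int_mult of_int_of_nat_eq)
    thus False using p1 by (simp add: zmult_eq_1_iff)
  qed
  \<comment> \<open>The exponent \<open>l x\<close> is an arbitrary choice, so it is additive only
    modulo \<open>p\<close>. This transfer from \<open>\<zeta>\<close> to \<open>\<omega>\<close>
    makes the choice irrelevant.\<close>
  have red: "\<omega> ^ i = \<omega> ^ j" if "\<zeta> ^ i = \<zeta> ^ j" for i j
  proof -
    have *: "\<omega> ^ i = \<omega> ^ j" if "\<zeta> ^ i = \<zeta> ^ j" "i \<le> j" for i j
    proof -
      have "\<zeta> ^ j = \<zeta> ^ i * \<zeta> ^ (j - i)" using that(2) by (simp flip: power_add)
      hence "\<zeta> ^ (j - i) = 1" using that \<zeta>(3) by simp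
      hence "p dvd j - i" by (rule dvd)
      hence "\<omega> ^ (j - i) = 1" using power_eq_1_dvd[OF \<omega>p] by simp
      moreover have "\<omega> ^ j = \<omega> ^ i * \<omega> ^ (j - i)" using that by (simp flip: power_add)
      ultimately show ?thesis by simp
    qed
    show ?thesis using *[OF that] *[OF that[symmetric]] nat_le_linear[of i j] by metis
  qed
  show ?thesis
  proof (rule that[of "\<lambda>x. \<omega> ^ l x"])
    fix x y :: 'a assume xy: "x \<noteq> 0" "y \<noteq> 0"
    have "\<zeta> ^ l (x * y) = \<zeta> ^ (l x + l y)"
      using xy by (simp add: l power_add power_mult_distrib)
    thus "\<omega> ^ l (x * y) = \<omega> ^ l x * \<omega> ^ l y" by (metis red power_add)
  next
    fix x :: 'a assume x: "x \<noteq> 0"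
    show "(\<omega> ^ l x) ^ p = 1" using \<omega>p by (simp add: power_commuting_exponents[of _ _ p])
    show "\<omega> ^ l x = 1 \<longleftrightarrow> x ^ (M div p) = 1"
    proof
      assume "x ^ (M div p) = 1"
      hence "\<zeta> ^ l x = \<zeta> ^ 0" using l x by simp
      hence "\<omega> ^ l x = \<omega> ^ 0" by (rule red)
      thus "\<omega> ^ l x = 1" by simp
    next
      assume *: "\<omega> ^ l x = 1"
      have "p dvd l x"
      proof (rule ccontr)
        assume "\<not> p dvd l x"
        hence "coprime p (l x)" using p(1) by (simp add: prime_imp_coprime)
        thus False using power_eq_1_coprime[OF \<omega>p *] p1 \<omega>1 by simp
      qed
      thus "x ^ (M div p) = 1" using l[OF x] power_eq_1_dvd[OF \<zeta>(2)] by simp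
    qed
  next
    have "\<omega> ^ l z \<noteq> 1"
    proof
      assume *: "\<omega> ^ l z = 1"
      have "\<not> p dvd l z" using l[OF z(1)] power_eq_1_dvd[OF \<zeta>(2)] z(2) by metis
      hence "coprime p (l z)" using p(1) by (simp add: prime_imp_coprime)
      thus False using power_eq_1_coprime[OF \<omega>p *] p1 \<omega>1 by simp
    qed
    thus "\<exists>z. z \<noteq> 0 \<and> \<omega> ^ l z \<noteq> 1" using z(1) by blast
  qed
qed

text \<open>
  The squares of the character sums over all translates of \<open>V\<close> add up to
  \<open>card V * (card UNIV - card V)\<close>, and the sum is constant on cosets; this replaces the usual
  appeal to Gauss sums.
\<close>

lemma norm_character_sum_coset_le:
  fixes \<chi> :: "'a::finite_field \<Rightarrow> complex" and V :: "'a set"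
  assumes chi0: "\<chi> 0 = 0" and mult: "\<And>x y. x \<noteq> 0 \<Longrightarrow> y \<noteq> 0 \<Longrightarrow> \<chi> (x * y) = \<chi> x * \<chi> y"
    and norm: "\<And>x. x \<noteq> 0 \<Longrightarrow> norm (\<chi> x) = 1" and nontriv: "\<exists>z. z \<noteq> 0 \<and> \<chi> z \<noteq> 1"
    and V: "0 \<in> V" "\<And>x y. x \<in> V \<Longrightarrow> y \<in> V \<Longrightarrow> x - y \<in> V"
  shows "norm (\<Sum>v\<in>V. \<chi> (c + v)) \<le> sqrt (card (UNIV :: 'a set))"
proof -
  define N where "N = card (UNIV :: 'a set)"
  have mult': "\<chi> (x * y) = \<chi> x * \<chi> y" for x y
    using mult[of x y] chi0 by (cases "x = 0"; cases "y = 0") auto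
  have add: "x + y \<in> V" if "x \<in> V" "y \<in> V" for x y
    using V(2)[OF that(1) V(2)[OF V(1) that(2)]] by simp
  have chi1: "\<chi> 1 = 1"
  proof -
    have "\<chi> 1 * \<chi> 1 = \<chi> 1" using mult[of 1 1] by simp
    moreover have "\<chi> 1 \<noteq> 0" using norm[of 1] by auto
    ultimately show ?thesis by simp
  qed
  have cnj: "\<chi> x * cnj (\<chi> x) = 1" if "x \<noteq> 0" for x
    using norm[OF that] by (simp add: complex_norm_square[symmetric])
  have sum0: "(\<Sum>x\<in>UNIV. \<chi> x) = 0"
  proof -
    obtain z where z: "z \<noteq> 0" "\<chi> z \<noteq> 1" using nontriv by blast
    have "(\<Sum>x\<in>UNIV. \<chi> x) = (\<Sum>x\<in>UNIV. \<chi> (z * x))"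
      using z(1) by (intro sum.reindex_bij_witness[of _ "\<lambda>x. z * x" "\<lambda>x. x / z"]) auto
    also have "\<dots> = \<chi> z * (\<Sum>x\<in>UNIV. \<chi> x)" by (simp add: mult' sum_distrib_left)
    finally show ?thesis using z(2) by (simp add: algebra_simps)
  qed
  \<comment> \<open>The autocorrelation of \<open>\<chi>\<close>. Away from 0, the substitution
    \<open>u = 1 + z / y\<close> reduces it to the complete sum with the term at 1 removed.\<close>
  define R where "R z = (\<Sum>y\<in>UNIV. \<chi> (y + z) * cnj (\<chi> y))" for z
  have R0: "R 0 = of_nat N - 1"
  proof -
    have "R 0 = (\<Sum>y\<in>UNIV - {0}. \<chi> y * cnj (\<chi> y))"
      unfolding R_def by (rule sum.mono_neutral_cong_right) (auto simp: chi0)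
    also have "\<dots> = (\<Sum>y\<in>UNIV - {0::'a}. 1)" by (intro sum.cong) (auto simp: cnj)
    also have "\<dots> = of_nat (N - 1)" by (simp add: N_def card_Diff_singleton)
    finally show ?thesis using finite_UNIV_card_ge_0[where 'a='a] by (simp add: N_def of_nat_diff Suc_leI)
  qed
  have Rz: "R z = -1" if z: "z \<noteq> 0" for z
  proof -
    have "R z = (\<Sum>y\<in>UNIV - {0}. \<chi> (y + z) * cnj (\<chi> y))"
      unfolding R_def by (rule sum.mono_neutral_cong_right) (auto simp: chi0)
    also have "\<dots> = (\<Sum>y\<in>UNIV - {0}. \<chi> (1 + z / y))"
    proof (rule sum.cong)
      fix y :: 'a assume y: "y \<in> UNIV - {0}"
      have "\<chi> (y + z) = \<chi> (y * (1 + z / y))" using y by (simp add: distrib_left)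
      thus "\<chi> (y + z) * cnj (\<chi> y) = \<chi> (1 + z / y)" using cnj[of y] y
        by (simp add: mult' mult_ac)
    qed simp
    also have "\<dots> = (\<Sum>u\<in>UNIV - {1}. \<chi> u)"
      using z by (intro sum.reindex_bij_witness[of _ "\<lambda>u. z / (u - 1)" "\<lambda>y. 1 + z / y"]) auto
    also have "\<dots> = -1" using sum0 chi1 by (simp add: sum_diff1)
    finally show ?thesis .
  qed
  define S where "S y = (\<Sum>v\<in>V. \<chi> (y + v))" for y
  have S_coset: "S (c + w) = S c" if "w \<in> V" for w
    unfolding S_def
    by (rule sum.reindex_bij_witness[of _ "\<lambda>v. v - w" "\<lambda>v. w + v"]) (auto simp: add V(2) that add_ac)
  have "(\<Sum>y\<in>UNIV. of_real ((norm (S y))\<^sup>2)) = (\<Sum>y\<in>UNIV. \<Sum>v\<in>V. \<Sum>w\<in>V. \<chi> (y + v) * cnj (\<chi> (y + w)))"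
    by (simp add: complex_norm_square S_def sum_product cnj_sum del: of_real_power)
  also have "\<dots> = (\<Sum>v\<in>V. \<Sum>w\<in>V. \<Sum>y\<in>UNIV. \<chi> (y + v) * cnj (\<chi> (y + w)))"
    by (subst sum.swap, rule sum.cong, rule refl, rule sum.swap)
  also have "\<dots> = (\<Sum>v\<in>V. \<Sum>w\<in>V. R (v - w))"
  proof (rule sum.cong[OF refl], rule sum.cong[OF refl])
    fix v w
    show "(\<Sum>y\<in>UNIV. \<chi> (y + v) * cnj (\<chi> (y + w))) = R (v - w)" unfolding R_def
      by (rule sum.reindex_bij_witness[of _ "\<lambda>y. y - w" "\<lambda>y. y + w"]) auto
  qed
  also have "\<dots> = (\<Sum>v\<in>V. of_nat N - of_nat (card V))"
  proof (rule sum.cong)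
    fix v assume v: "v \<in> V"
    have "(\<Sum>w\<in>V. R (v - w)) = (\<Sum>w\<in>V. (if w = v then of_nat N else 0) - 1)"
      by (intro sum.cong) (auto simp: R0 Rz)
    also have "\<dots> = of_nat N - of_nat (card V)" using v by (simp add: sum_subtractf)
    finally show "(\<Sum>w\<in>V. R (v - w)) = of_nat N - of_nat (card V)" .
  qed simp
  also have "\<dots> = of_real (real (card V) * (real N - real (card V)))" by simp
  finally have "(\<Sum>y\<in>UNIV. (norm (S y))\<^sup>2) = real (card V) * (real N - real (card V))"
    unfolding of_real_sum[symmetric] of_real_eq_iff .
  \<comment> \<open>Only the points of \<open>c + V\<close> are kept from the second moment. They
    all carry the same value, so \<open>card V\<close> cancels.\<close>
  moreover have "(\<Sum>y\<in>(\<lambda>w. c + w) ` V. (norm (S y))\<^sup>2) \<le> (\<Sum>y\<in>UNIV. (norm (S y))\<^sup>2)"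
    by (intro sum_mono2) auto
  moreover have "(\<Sum>y\<in>(\<lambda>w. c + w) ` V. (norm (S y))\<^sup>2) = (\<Sum>w\<in>V. (norm (S (c + w)))\<^sup>2)"
    by (subst sum.reindex) auto
  moreover have "\<dots> = real (card V) * (norm (S c))\<^sup>2" by (simp add: S_coset)
  ultimately have "real (card V) * (norm (S c))\<^sup>2 \<le> real (card V) * (real N - real (card V))" by simp
  moreover have "card V > 0" using V(1) by (auto simp: card_gt_0_iff)
  ultimately have "(norm (S c))\<^sup>2 \<le> real N" by simp
  thus ?thesis unfolding S_def N_def by (rule real_le_rsqrt)
qed

subsection \<open>The sieve\<close>

text \<open>For nonzero \<open>x\<close> and a prime \<open>p\<close> dividing the group order, the
  tested equation characterizes the \<open>p\<close>-th powers. With all such primes in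
  \<open>S\<close>, \<open>free_count S C\<close> is the number of primitive elements in
  \<open>C\<close>.\<close>

definition power_free :: "nat \<Rightarrow> 'a::finite_field \<Rightarrow> real" where
  "power_free p x = (if x ^ ((card (UNIV :: 'a set) - 1) div p) = 1 then 0 else 1)"

definition free_count :: "nat set \<Rightarrow> 'a::finite_field set \<Rightarrow> real" where
  "free_count S C = (\<Sum>x\<in>C - {0}. \<Prod>p\<in>S. power_free p x)"

lemma power_free_nonneg: "power_free p x \<ge> 0" and power_free_le_1: "power_free p x \<le> 1"
  by (auto simp: power_free_def)

lemma sum_powers_root_of_unity:
  fixes z :: "'a::field"
  assumes "z ^ p = 1"
  shows "(\<Sum>b<p. z ^ b) = (if z = 1 then of_nat p else 0)"
  using assms by (auto simp: sum_gp_strict)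

text \<open>The Fourier coefficients of \<open>power_free p\<close> with respect to the powers of a
  character of order \<open>p\<close>, read off from "1 minus the mean of all powers".\<close>

definition free_coeff :: "nat \<Rightarrow> nat \<Rightarrow> real" where
  "free_coeff p b = (if b = 0 then 1 - 1 / p else - (1 / p))"

lemma power_free_expansion:
  fixes x :: "'a::finite_field" and z :: complex
  assumes p: "p > 0" and z: "z ^ p = 1" "z = 1 \<longleftrightarrow> x ^ ((card (UNIV :: 'a set) - 1) div p) = 1"
  shows "of_real (power_free p x) = (\<Sum>b<p. of_real (free_coeff p b) * z ^ b)"
proof -
  have "(\<Sum>b<p. of_real (free_coeff p b) * z ^ b) = (\<Sum>b<p. (if b = 0 then 1 else 0) - z ^ b / of_nat p)"
    by (intro sum.cong) (auto simp: free_coeff_def)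
  also have "\<dots> = 1 - (\<Sum>b<p. z ^ b) / of_nat p"
    using p by (simp add: sum_subtractf sum_divide_distrib)
  also have "\<dots> = of_real (power_free p x)"
    using p z by (simp add: sum_powers_root_of_unity power_free_def)
  finally show ?thesis by simp
qed

lemma sum_abs_free_coeff:
  assumes "p > 0"
  shows "(\<Sum>b\<in>{1..<p}. \<bar>free_coeff p b\<bar>) = 1 - 1 / p"
    and "(\<Sum>b<p. \<bar>free_coeff p b\<bar>) = 2 * (1 - 1 / p)"
proof -
  show *: "(\<Sum>b\<in>{1..<p}. \<bar>free_coeff p b\<bar>) = 1 - 1 / p"
    using assms by (simp add: free_coeff_def of_nat_diff field_simps)
  have "{..<p} = insert 0 {1..<p}" using assms by auto
  thus "(\<Sum>b<p. \<bar>free_coeff p b\<bar>) = 2 * (1 - 1 / p)"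
    using * assms by (simp add: free_coeff_def)
qed

text \<open>Expanding the product gives one multiplicative character for each choice of exponents.
  The index sets \<open>J p\<close> are left free so that the exponent 0 can be forbidden at the
  single prime \<open>r\<close>, which makes every character that occurs nontrivial.\<close>

lemma norm_free_product_sum_le:
  fixes c :: "'a::finite_field" and V :: "'a set" and J :: "nat \<Rightarrow> nat set"
    and \<eta> :: "nat \<Rightarrow> 'a \<Rightarrow> complex"
  assumes S: "finite S" "\<And>p. p \<in> S \<Longrightarrow> prime p"
    and eta: "\<And>p x y. p \<in> S \<Longrightarrow> x \<noteq> 0 \<Longrightarrow> y \<noteq> 0 \<Longrightarrow> \<eta> p (x * y) = \<eta> p x * \<eta> p y"
      "\<And>p x. p \<in> S \<Longrightarrow> x \<noteq> 0 \<Longrightarrow> \<eta> p x ^ p = 1"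
      "\<And>p. p \<in> S \<Longrightarrow> \<exists>z. z \<noteq> 0 \<and> \<eta> p z \<noteq> 1"
    and J: "\<And>p. p \<in> S \<Longrightarrow> J p \<subseteq> {..<p}" and r: "r \<in> S" "0 \<notin> J r"
    and V: "0 \<in> V" "\<And>x y. x \<in> V \<Longrightarrow> y \<in> V \<Longrightarrow> x - y \<in> V"
  shows "norm (\<Sum>x\<in>(\<lambda>v. c + v) ` V - {0}. \<Prod>p\<in>S. \<Sum>b\<in>J p. of_real (w p b) * \<eta> p x ^ b)
    \<le> (\<Prod>p\<in>S. \<Sum>b\<in>J p. \<bar>w p b\<bar>) * sqrt (card (UNIV :: 'a set))"
proof -
  let ?C = "(\<lambda>v. c + v) ` V" and ?R = "sqrt (card (UNIV :: 'a set))"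
  define B where "B = Pi\<^sub>E S J"
  have finJ: "finite (J p)" if "p \<in> S" for p using J[OF that] finite_subset by blast
  define \<chi> where "\<chi> b x = (if x = 0 then 0 else \<Prod>p\<in>S. \<eta> p x ^ b p)" for b :: "nat \<Rightarrow> nat" and x
  have norm1: "norm (\<eta> p x) = 1" if "p \<in> S" "x \<noteq> 0" for p x
  proof -
    have "norm (\<eta> p x) ^ p = 1" using eta(2)[OF that] by (metis norm_one norm_power)
    moreover have "p > 0" using S(2)[OF that(1)] by (rule prime_gt_0_nat)
    ultimately show ?thesis using power_eq_imp_eq_base[of "norm (\<eta> p x)" p 1] by simp
  qed
  have char: "norm (\<Sum>v\<in>V. \<chi> b (c + v)) \<le> ?R" if b: "b \<in> B" for b
  proof (rule norm_character_sum_coset_le)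
    show "\<chi> b 0 = 0" by (simp add: \<chi>_def)
    show "\<chi> b (x * y) = \<chi> b x * \<chi> b y" if "x \<noteq> 0" "y \<noteq> 0" for x y
      using that by (simp add: \<chi>_def eta(1) power_mult_distrib prod.distrib)
    show "norm (\<chi> b x) = 1" if "x \<noteq> 0" for x
      using that by (simp add: \<chi>_def norm_power norm1 flip: prod_norm)
    show "\<exists>z. z \<noteq> 0 \<and> \<chi> b z \<noteq> 1"
    proof -
      \<comment> \<open>Raising \<open>z\<close> to the product of the other primes trivializes
        their characters. The character at \<open>r\<close> survives, because \<open>r\<close>
        divides neither that product nor \<open>b r\<close>.\<close>
      obtain z where z: "z \<noteq> 0" "\<eta> r z \<noteq> 1" using eta(3)[OF r(1)] by blast
      define k where "k = \<Prod>(S - {r})"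
      have pow: "\<eta> p (z ^ i) = \<eta> p z ^ i" if "p \<in> S" for p i
      proof (induction i)
        case 0
        have "\<eta> p (1 * 1) = \<eta> p 1 * \<eta> p 1" by (rule eta(1)[OF that]) auto
        moreover have "\<eta> p 1 \<noteq> 0" using norm1[OF that, of 1] by auto
        ultimately show ?case by simp
      qed (use z eta(1)[OF that] in auto)
      have others: "\<eta> p (z ^ k) = 1" if "p \<in> S - {r}" for p
      proof -
        have "p dvd k" unfolding k_def using S(1) that by (intro dvd_prodI) auto
        thus ?thesis using pow[of p k] that eta(2)[of p z] z(1) power_eq_1_dvd by simp
      qed
      have "\<chi> b (z ^ k) = (\<Prod>p\<in>S. \<eta> p (z ^ k) ^ b p)" using z(1) by (simp add: \<chi>_def)
      also have "\<dots> = \<eta> r (z ^ k) ^ b r * (\<Prod>p\<in>S - {r}. \<eta> p (z ^ k) ^ b p)"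
        by (rule prod.remove[OF S(1) r(1)])
      also have "(\<Prod>p\<in>S - {r}. \<eta> p (z ^ k) ^ b p) = 1"
        by (rule prod.neutral) (simp add: others)
      finally have eq: "\<chi> b (z ^ k) = \<eta> r z ^ (k * b r)" by (simp add: pow[OF r(1)] power_mult)
      have pr: "prime r" using S(2) r(1) .
      have "b r \<in> J r" using b r(1) by (auto simp: B_def PiE_def)
      hence "0 < b r" "b r < r" using J[OF r(1)] r(2) by (auto intro: gr0I)
      hence "\<not> r dvd b r" by (simp add: nat_dvd_not_less)
      moreover have "\<not> r dvd k"
      proof
        assume "r dvd k"
        then obtain p where p: "p \<in> S - {r}" "r dvd p"
          unfolding k_def using prime_dvd_prod_iff[of "S - {r}" r "\<lambda>x. x"] S(1) pr by auto
        thus False using S(2)[of p] pr primes_dvd_imp_eq[of r p] by auto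
      qed
      ultimately have "coprime r (k * b r)" using pr by (simp add: prime_imp_coprime prime_dvd_mult_iff)
      hence "\<eta> r z ^ (k * b r) \<noteq> 1"
        using power_eq_1_coprime[OF eta(2)[OF r(1) z(1)]] z(2) pr prime_gt_0_nat by blast
      thus ?thesis using eq z(1) by (intro exI[of _ "z ^ k"]) auto
    qed
  qed (use V in auto)
  have "(\<Sum>x\<in>?C - {0}. \<Prod>p\<in>S. \<Sum>b\<in>J p. of_real (w p b) * \<eta> p x ^ b)
      = (\<Sum>x\<in>?C - {0}. \<Sum>b\<in>B. \<Prod>p\<in>S. of_real (w p (b p)) * \<eta> p x ^ b p)"
    unfolding B_def using finJ S(1) by (intro sum.cong refl prod_sum_PiE) auto
  also have "\<dots> = (\<Sum>b\<in>B. \<Sum>x\<in>?C - {0}. \<Prod>p\<in>S. of_real (w p (b p)) * \<eta> p x ^ b p)"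
    by (rule sum.swap)
  also have "\<dots> = (\<Sum>b\<in>B. of_real (\<Prod>p\<in>S. w p (b p)) * (\<Sum>v\<in>V. \<chi> b (c + v)))"
  proof (rule sum.cong[OF refl])
    fix b
    have "(\<Sum>x\<in>?C - {0}. \<Prod>p\<in>S. of_real (w p (b p)) * \<eta> p x ^ b p)
        = (\<Sum>x\<in>?C - {0}. of_real (\<Prod>p\<in>S. w p (b p)) * \<chi> b x)"
      by (intro sum.cong refl) (auto simp: \<chi>_def prod.distrib)
    also have "\<dots> = (\<Sum>x\<in>?C. of_real (\<Prod>p\<in>S. w p (b p)) * \<chi> b x)"
      by (rule sum.mono_neutral_left) (auto simp: \<chi>_def)
    also have "\<dots> = of_real (\<Prod>p\<in>S. w p (b p)) * (\<Sum>v\<in>V. \<chi> b (c + v))"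
      by (subst sum.reindex) (auto simp: sum_distrib_left)
    finally show "(\<Sum>x\<in>?C - {0}. \<Prod>p\<in>S. of_real (w p (b p)) * \<eta> p x ^ b p)
      = of_real (\<Prod>p\<in>S. w p (b p)) * (\<Sum>v\<in>V. \<chi> b (c + v))" .
  qed
  also have "norm \<dots> \<le> (\<Sum>b\<in>B. \<bar>\<Prod>p\<in>S. w p (b p)\<bar> * ?R)"
    by (rule sum_norm_le) (simp add: norm_mult char mult_left_mono del: of_real_prod)
  also have "\<dots> = (\<Sum>b\<in>B. \<Prod>p\<in>S. \<bar>w p (b p)\<bar>) * ?R" by (simp add: sum_distrib_right abs_prod)
  also have "(\<Sum>b\<in>B. \<Prod>p\<in>S. \<bar>w p (b p)\<bar>) = (\<Prod>p\<in>S. \<Sum>b\<in>J p. \<bar>w p b\<bar>)"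
    unfolding B_def using finJ S(1) by (intro prod_sum_PiE[symmetric]) auto
  finally show ?thesis .
qed

text \<open>Subtracting its mean \<open>1 - 1 / r\<close> from \<open>power_free r\<close> removes
  exactly the trivial character at \<open>r\<close>. The remaining coefficients at \<open>r\<close>
  have absolute sum \<open>1 - 1 / r\<close>, so only the primes of \<open>S\<close> contribute a
  factor 2.\<close>

lemma free_count_insert:
  fixes c :: "'a::finite_field" and V :: "'a set"
  assumes S: "finite S" "\<And>p. p \<in> insert r S \<Longrightarrow> prime p \<and> p dvd card (UNIV :: 'a set) - 1"
    and r: "r \<notin> S"
    and V: "0 \<in> V" "\<And>x y. x \<in> V \<Longrightarrow> y \<in> V \<Longrightarrow> x - y \<in> V"
  defines "C \<equiv> (\<lambda>v. c + v) ` V"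
  shows "\<bar>free_count (insert r S) C - (1 - 1 / r) * free_count S C\<bar>
    \<le> (1 - 1 / r) * ((\<Prod>p\<in>S. 1 - 1 / p) * 2 ^ card S * sqrt (card (UNIV :: 'a set)))"
proof -
  define P where "P p \<eta> \<longleftrightarrow>
      (\<forall>x y. x \<noteq> 0 \<longrightarrow> y \<noteq> 0 \<longrightarrow> \<eta> (x * y) = \<eta> x * \<eta> y) \<and> (\<forall>x. x \<noteq> 0 \<longrightarrow> \<eta> x ^ p = 1) \<and>
      (\<forall>x. x \<noteq> 0 \<longrightarrow> (\<eta> x = 1 \<longleftrightarrow> x ^ ((card (UNIV :: 'a set) - 1) div p) = 1)) \<and>
      (\<exists>z. z \<noteq> 0 \<and> \<eta> z \<noteq> 1)" for p and \<eta> :: "'a \<Rightarrow> complex"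
  have "\<exists>\<eta>. P p \<eta>" if "p \<in> insert r S" for p
  proof -
    from S(2)[OF that] have p: "prime p" "p dvd card (UNIV :: 'a set) - 1" by auto
    show ?thesis
    proof (rule ex_character_prime_order[OF p])
      fix \<eta> :: "'a \<Rightarrow> complex"
      assume "\<And>x y. x \<noteq> 0 \<Longrightarrow> y \<noteq> 0 \<Longrightarrow> \<eta> (x * y) = \<eta> x * \<eta> y" "\<And>x. x \<noteq> 0 \<Longrightarrow> \<eta> x ^ p = 1"
        "\<And>x. x \<noteq> 0 \<Longrightarrow> \<eta> x = 1 \<longleftrightarrow> x ^ ((card (UNIV :: 'a set) - 1) div p) = 1"
        "\<exists>z. z \<noteq> 0 \<and> \<eta> z \<noteq> 1"
      hence "P p \<eta>" unfolding P_def by blast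
      thus "\<exists>\<eta>. P p \<eta>" by blast
    qed
  qed
  hence "\<exists>\<eta>. \<forall>p\<in>insert r S. P p (\<eta> p)" by (intro bchoice) blast
  then obtain \<eta> where \<eta>: "\<And>p. p \<in> insert r S \<Longrightarrow> P p (\<eta> p)" by blast
  have eta: "\<And>p x y. p \<in> insert r S \<Longrightarrow> x \<noteq> 0 \<Longrightarrow> y \<noteq> 0 \<Longrightarrow> \<eta> p (x * y) = \<eta> p x * \<eta> p y"
    "\<And>p x. p \<in> insert r S \<Longrightarrow> x \<noteq> 0 \<Longrightarrow> \<eta> p x ^ p = 1"
    "\<And>p x. p \<in> insert r S \<Longrightarrow> x \<noteq> 0 \<Longrightarrow> \<eta> p x = 1 \<longleftrightarrow> x ^ ((card (UNIV :: 'a set) - 1) div p) = 1"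
    "\<And>p. p \<in> insert r S \<Longrightarrow> \<exists>z. z \<noteq> 0 \<and> \<eta> p z \<noteq> 1"
    using \<eta> unfolding P_def by blast+
  have pos: "p > 0" if "p \<in> insert r S" for p using S(2)[OF that] prime_gt_0_nat by blast
  define J where "J p = (if p = r then {1..<r} else {..<p})" for p
  have exp: "of_real (power_free p x) = (\<Sum>b<p. of_real (free_coeff p b) * \<eta> p x ^ b)"
    if "p \<in> insert r S" "x \<noteq> 0" for p x
    using that eta by (intro power_free_expansion pos) auto
  have exp_r: "of_real (power_free r x - (1 - 1 / r)) = (\<Sum>b\<in>{1..<r}. of_real (free_coeff r b) * \<eta> r x ^ b)"
    if "x \<noteq> 0" for x
  proof -
    have "{..<r} = insert 0 {1..<r}" using pos[of r] by auto
    thus ?thesis using exp[of r x] that by (simp add: free_coeff_def)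
  qed
  have "of_real (free_count (insert r S) C - (1 - 1 / r) * free_count S C)
      = (\<Sum>x\<in>C - {0}. of_real ((power_free r x - (1 - 1 / r)) * (\<Prod>p\<in>S. power_free p x)) :: complex)"
    unfolding of_real_sum[symmetric] of_real_eq_iff
    using S(1) r by (simp add: free_count_def sum_distrib_left sum_subtractf left_diff_distrib)
  also have "\<dots> = (\<Sum>x\<in>C - {0}. \<Prod>p\<in>insert r S. \<Sum>b\<in>J p. of_real (free_coeff p b) * \<eta> p x ^ b)"
  proof (rule sum.cong[OF refl])
    fix x assume x: "x \<in> C - {0}"
    have "(\<Prod>p\<in>S. of_real (power_free p x)) = (\<Prod>p\<in>S. \<Sum>b\<in>J p. of_real (free_coeff p b) * \<eta> p x ^ b)"
      using x r by (intro prod.cong refl) (auto simp: exp J_def)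
    thus "of_real ((power_free r x - (1 - 1 / r)) * (\<Prod>p\<in>S. power_free p x)) =
      (\<Prod>p\<in>insert r S. \<Sum>b\<in>J p. of_real (free_coeff p b) * \<eta> p x ^ b)"
      using S(1) r x by (simp add: exp_r J_def del: of_real_diff)
  qed
  also have "norm \<dots> \<le> (\<Prod>p\<in>insert r S. \<Sum>b\<in>J p. \<bar>free_coeff p b\<bar>) * sqrt (card (UNIV :: 'a set))"
    unfolding C_def
    by (rule norm_free_product_sum_le[where r = r]) (use S eta V in \<open>auto simp: J_def\<close>)
  also have "(\<Prod>p\<in>insert r S. \<Sum>b\<in>J p. \<bar>free_coeff p b\<bar>) = (1 - 1 / r) * (2 ^ card S * (\<Prod>p\<in>S. 1 - 1 / p))"
  proof -
    have "(\<Prod>p\<in>S. \<Sum>b\<in>J p. \<bar>free_coeff p b\<bar>) = (\<Prod>p\<in>S. 2 * (1 - 1 / p))"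
      using r by (intro prod.cong refl) (auto simp: J_def sum_abs_free_coeff pos)
    also have "\<dots> = 2 ^ card S * (\<Prod>p\<in>S. 1 - 1 / p)" unfolding prod.distrib by simp
    finally have "(\<Prod>p\<in>S. \<Sum>b\<in>J p. \<bar>free_coeff p b\<bar>) = 2 ^ card S * (\<Prod>p\<in>S. 1 - 1 / p)" .
    thus ?thesis using S(1) r sum_abs_free_coeff(1)[of r] pos[of r] by (simp add: J_def)
  qed
  finally show ?thesis by (simp add: mult_ac flip: of_real_diff of_real_mult)
qed

text \<open>Inserting the primes one by one costs errors proportional to 1, 2, 4 and so on, which
  add up to \<open>2 ^ card S - 1\<close>.\<close>

lemma free_count_ge:
  fixes c :: "'a::finite_field" and V :: "'a set"
  assumes "finite S" "\<And>p. p \<in> S \<Longrightarrow> prime p \<and> p dvd card (UNIV :: 'a set) - 1"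
    and V: "0 \<in> V" "\<And>x y. x \<in> V \<Longrightarrow> y \<in> V \<Longrightarrow> x - y \<in> V"
  defines "C \<equiv> (\<lambda>v. c + v) ` V"
  shows "free_count S C
    \<ge> (\<Prod>p\<in>S. 1 - 1 / p) * (card (C - {0}) - (2 ^ card S - 1) * sqrt (card (UNIV :: 'a set)))"
  using assms(1,2)
proof (induction S rule: finite_induct)
  case empty
  show ?case by (simp add: free_count_def)
next
  case (insert r S)
  let ?t = "\<Prod>p\<in>S. 1 - 1 / real p" and ?R = "sqrt (card (UNIV :: 'a set))"
  have r: "1 - 1 / real r \<ge> 0" using insert.prems[of r] prime_gt_0_nat[of r] by simp
  have "(1 - 1 / r) * (?t * (card (C - {0}) - (2 ^ card S - 1) * ?R)) \<le> (1 - 1 / r) * free_count S C"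
    using insert by (intro mult_left_mono r) auto
  moreover have "\<bar>free_count (insert r S) C - (1 - 1 / r) * free_count S C\<bar>
    \<le> (1 - 1 / r) * (?t * 2 ^ card S * ?R)"
    unfolding C_def by (rule free_count_insert) (use insert V in auto)
  ultimately have "free_count (insert r S) C \<ge> (1 - 1 / r) * (?t * (card (C - {0}) - (2 ^ card S - 1) * ?R))
      - (1 - 1 / r) * (?t * 2 ^ card S * ?R)"
    by linarith
  also have "(1 - 1 / r) * (?t * (card (C - {0}) - (2 ^ card S - 1) * ?R))
      - (1 - 1 / r) * (?t * 2 ^ card S * ?R) =
      (1 - 1 / r) * ?t * (card (C - {0}) - (2 ^ card (insert r S) - 1) * ?R)"
    using insert(1,2) by (simp add: algebra_simps add_divide_distrib)
  finally show ?case using insert(1,2) by simp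
qed

text \<open>The union bound, in a form suited to indicator functions.\<close>

lemma prod_ge_sum_minus:
  fixes f :: "'b \<Rightarrow> real"
  assumes "finite T" "\<And>i. i \<in> T \<Longrightarrow> 0 \<le> f i \<and> f i \<le> 1"
  shows "(\<Prod>i\<in>T. f i) \<ge> (\<Sum>i\<in>T. f i) - card T + 1"
  using assms
proof (induction T rule: finite_induct)
  case (insert i T)
  have P: "0 \<le> prod f T" "prod f T \<le> 1" using insert by (auto intro!: prod_nonneg prod_le_1)
  have "(1 - f i) * (1 - prod f T) \<ge> 0" using P insert.prems[of i] by (intro mult_nonneg_nonneg) auto
  thus ?case using insert by (auto simp: algebra_simps)
qed auto

text \<open>
  The primes of \<open>S\<close> are excluded by characters, those of \<open>T\<close> one at a time and then jointly by
  \<open>prod_ge_sum_minus\<close>.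
\<close>

lemma primitive_element_in_coset:
  fixes c :: "'a::finite_field" and V :: "'a set"
  assumes fin: "finite S" "finite T" and disj: "S \<inter> T = {}"
    and ST: "S \<union> T = {p. prime p \<and> p dvd card (UNIV :: 'a set) - 1}"
    and V: "0 \<in> V" "\<And>x y. x \<in> V \<Longrightarrow> y \<in> V \<Longrightarrow> x - y \<in> V"
    and Delta: "\<Delta> = 1 - (\<Sum>p\<in>T. 1 / p)" "\<Delta> > 0"
    and large: "real (card V) \<ge> sqrt (card (UNIV :: 'a set)) * (2 ^ card S * ((real (card T) - 1) / \<Delta> + 2))"
  shows "\<exists>v\<in>V. primitive_element (c + v)"
proof -
  define C where "C = (\<lambda>v. c + v) ` V"
  define R where "R = sqrt (card (UNIV :: 'a set))"
  define \<theta> where "\<theta> = (\<Prod>p\<in>S. 1 - 1 / real p)"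
  define W where "W = (2::real) ^ card S"
  have "card {0, 1::'a} \<le> card (UNIV :: 'a set)" by (intro card_mono) auto
  hence R1: "R > 1" unfolding R_def by simp
  have \<theta>: "\<theta> > 0" unfolding \<theta>_def
  proof (rule prod_pos)
    fix p assume "p \<in> S"
    hence "prime p" using ST by blast
    thus "0 < 1 - 1 / real p" using prime_gt_1_nat[of p] by simp
  qed
  have S: "prime p \<and> p dvd card (UNIV :: 'a set) - 1" if "p \<in> S" for p using ST that by blast
  have T: "prime p \<and> p dvd card (UNIV :: 'a set) - 1" if "p \<in> T" for p using ST that by blast
  have cardC: "card C = card V" unfolding C_def by (simp add: card_image)
  have "real (card (C - {0})) \<ge> real (card V) - 1"
    using cardC diff_card_le_card_Diff[of "{0}" C] by simp
  \<comment> \<open>A possible zero in \<open>C\<close> costs less than \<open>R\<close>. This loss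
    is exactly offset by the \<open>- 1\<close> in \<open>(W - 1) * R\<close>.\<close>
  hence A0: "real (card (C - {0})) > real (card V) - R" using R1 by linarith
  have cS: "free_count S C \<ge> \<theta> * (card (C - {0}) - (W - 1) * R)"
    unfolding C_def \<theta>_def R_def W_def using fin(1) S V by (intro free_count_ge) auto
  have "W * (real (card T) - 1) / \<Delta> + 2 * W = W * ((real (card T) - 1) / \<Delta> + 2)" by (simp add: algebra_simps)
  hence "card (C - {0}) > R * (W * (real (card T) - 1) / \<Delta> + 2 * W) - R"
    using A0 large unfolding R_def[symmetric] W_def[symmetric] by simp
  hence "card (C - {0}) - (W - 1) * R > R * W * ((real (card T) - 1) / \<Delta> + 1)"
    by (simp add: algebra_simps)
  hence "\<theta> * (card (C - {0}) - (W - 1) * R) > \<theta> * (R * W * ((real (card T) - 1) / \<Delta> + 1))"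
    using \<theta> by simp
  hence "free_count S C > \<theta> * (R * W * ((real (card T) - 1) / \<Delta> + 1))" using cS by linarith
  hence "\<Delta> * free_count S C > \<Delta> * (\<theta> * (R * W * ((real (card T) - 1) / \<Delta> + 1)))"
    using Delta(2) by simp
  moreover have "\<Delta> * (\<theta> * (R * W * ((real (card T) - 1) / \<Delta> + 1))) = \<theta> * W * R * (real (card T) - 1 + \<Delta>)"
    using Delta(2) by (simp add: field_simps)
  ultimately have main: "\<Delta> * free_count S C > \<theta> * W * R * (real (card T) - 1 + \<Delta>)" by simp
  have one: "free_count (insert p S) C \<ge> (1 - 1 / p) * (free_count S C - \<theta> * W * R)" if p: "p \<in> T" for p
  proof -
    have "\<bar>free_count (insert p S) C - (1 - 1 / p) * free_count S C\<bar> \<le> (1 - 1 / p) * (\<theta> * W * R)"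
      unfolding C_def \<theta>_def W_def R_def
      by (rule free_count_insert) (use p fin(1) S T disj V in auto)
    thus ?thesis by (simp add: algebra_simps)
  qed
  have "free_count (S \<union> T) C = (\<Sum>x\<in>C - {0}. (\<Prod>p\<in>S. power_free p x) * (\<Prod>p\<in>T. power_free p x))"
    unfolding free_count_def using fin disj by (simp add: prod.union_disjoint)
  also have "\<dots> \<ge> (\<Sum>x\<in>C - {0}. (\<Prod>p\<in>S. power_free p x) * ((\<Sum>p\<in>T. power_free p x) - real (card T) + 1))"
    using fin(2) by (intro sum_mono mult_left_mono prod_ge_sum_minus prod_nonneg)
      (auto simp: power_free_nonneg power_free_le_1)
  also have "(\<Sum>x\<in>C - {0}. (\<Prod>p\<in>S. power_free p x) * ((\<Sum>p\<in>T. power_free p x) - real (card T) + 1))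
      = (\<Sum>p\<in>T. free_count (insert p S) C) - (real (card T) - 1) * free_count S C"
  proof -
    have "(\<Sum>p\<in>T. free_count (insert p S) C)
        = (\<Sum>p\<in>T. \<Sum>x\<in>C - {0}. power_free p x * (\<Prod>p\<in>S. power_free p x))"
      unfolding free_count_def using fin(1) disj by (intro sum.cong refl prod.insert) auto
    also have "\<dots> = (\<Sum>x\<in>C - {0}. \<Sum>p\<in>T. power_free p x * (\<Prod>p\<in>S. power_free p x))"
      by (rule sum.swap)
    also have "\<dots> = (\<Sum>x\<in>C - {0}. (\<Prod>p\<in>S. power_free p x) * (\<Sum>p\<in>T. power_free p x))"
      by (simp add: sum_distrib_right mult_ac)
    finally show ?thesis
      by (simp add: free_count_def sum_subtractf sum.distrib distrib_left right_diff_distrib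
          left_diff_distrib mult_ac flip: sum_distrib_left)
  qed
  finally have "free_count (S \<union> T) C \<ge> (\<Sum>p\<in>T. free_count (insert p S) C) - (real (card T) - 1) * free_count S C" .
  moreover have "(\<Sum>p\<in>T. free_count (insert p S) C) \<ge> (\<Sum>p\<in>T. (1 - 1 / p) * (free_count S C - \<theta> * W * R))"
    by (rule sum_mono) (rule one)
  \<comment> \<open>The mean values \<open>1 - 1 / p\<close> over \<open>T\<close> add up to
    \<open>card T - 1 + \<Delta>\<close>, so after the subtraction a multiple
    \<open>\<Delta>\<close> of the main term is left.\<close>
  moreover have "(\<Sum>p\<in>T. (1 - 1 / p) * (free_count S C - \<theta> * W * R))
      = (real (card T) - 1 + \<Delta>) * (free_count S C - \<theta> * W * R)"
    by (simp add: Delta(1) sum_subtractf flip: sum_distrib_right)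
  moreover have "(real (card T) - 1 + \<Delta>) * (free_count S C - \<theta> * W * R) - (real (card T) - 1) * free_count S C
      = \<Delta> * free_count S C - \<theta> * W * R * (real (card T) - 1 + \<Delta>)" by (simp add: algebra_simps)
  ultimately have "free_count (S \<union> T) C \<noteq> 0" using main by linarith
  then obtain x where x: "x \<in> C - {0}" "(\<Prod>p\<in>S \<union> T. power_free p x) \<noteq> 0"
    unfolding free_count_def by (meson sum.not_neutral_contains_not_neutral)
  have "primitive_element x"
  proof (rule primitive_elementI)
    fix p assume "prime p" "p dvd card (UNIV :: 'a set) - 1"
    hence "p \<in> S \<union> T" using ST by blast
    hence "power_free p x \<noteq> 0" using x(2) fin by (metis finite_UnI prod_zero_iff)
    thus "x ^ ((card (UNIV :: 'a set) - 1) div p) \<noteq> 1" by (auto simp: power_free_def)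
  qed (use x in auto)
  thus ?thesis using x unfolding C_def by blast
qed

subsection \<open>Elements with prescribed traces\<close>

text \<open>Over the integers, polynomials without common factor need not satisfy a Bezout identity
  (2 and \<open>x\<close> do not). The identity itself is what yields operators on the field, so it
  is taken as the definition.\<close>

definition comaximal :: "'a::comm_ring_1 \<Rightarrow> 'a \<Rightarrow> bool" where
  "comaximal a b \<longleftrightarrow> (\<exists>u v. u * a + v * b = 1)"

lemma comaximalI: "u * a + v * b = 1 \<Longrightarrow> comaximal a b"
  unfolding comaximal_def by blast

lemma comaximal_commute: "comaximal a b \<longleftrightarrow> comaximal b a"
proof -
  have "comaximal b a" if "comaximal a b" for a b :: 'a
    using that unfolding comaximal_def by (subst add.commute) blast
  thus ?thesis by blast
qed

lemma comaximal_1_right [simp]: "comaximal a 1"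
  by (rule comaximalI[of 0 _ 1]) simp

lemma comaximal_mult_right:
  assumes "comaximal a b" "comaximal a c"
  shows "comaximal a (b * c)"
proof -
  from assms obtain u v u' v' where "u * a + v * b = 1" "u' * a + v' * c = 1"
    unfolding comaximal_def by blast
  hence "(u * a + v * b) * (u' * a + v' * c) = 1" by simp
  hence "(u * u' * a + u * v' * c + v * b * u') * a + (v * v') * (b * c) = 1"
    by (simp add: algebra_simps)
  thus ?thesis by (rule comaximalI)
qed

lemma comaximal_prod_right:
  assumes "finite I" "\<And>i. i \<in> I \<Longrightarrow> comaximal a (f i)"
  shows "comaximal a (\<Prod>i\<in>I. f i)"
  using assms by (induction I rule: finite_induct) (auto intro: comaximal_mult_right)

lemma comaximal_dvd_mult:
  assumes "comaximal a b" "a dvd c" "b dvd c"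
  shows "a * b dvd c"
proof -
  obtain u v where uv: "u * a + v * b = 1" using assms(1) unfolding comaximal_def by blast
  have "c = c * (u * a + v * b)" unfolding uv by simp
  also have "\<dots> = u * (a * c) + v * (c * b)" by (simp add: algebra_simps)
  finally have "c = u * (a * c) + v * (c * b)" .
  moreover have "a * b dvd u * (a * c) + v * (c * b)"
    using assms(2,3) by (intro dvd_add dvd_mult mult_dvd_mono) auto
  ultimately show ?thesis by simp
qed

lemma comaximal_prod_dvd:
  assumes "finite I" "\<And>i j. i \<in> I \<Longrightarrow> j \<in> I \<Longrightarrow> i \<noteq> j \<Longrightarrow> comaximal (f i) (f j)"
    and "\<And>i. i \<in> I \<Longrightarrow> f i dvd c"
  shows "(\<Prod>i\<in>I. f i) dvd c"
  using assms
proof (induction I rule: finite_induct)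
  case (insert i I)
  have "comaximal (f i) (prod f I)" by (rule comaximal_prod_right) (use insert in auto)
  thus ?case using insert by (auto intro!: comaximal_dvd_mult)
qed auto

text \<open>The Chinese remainder construction: when \<open>f i\<close> joins the family, the old
  identity is multiplied by \<open>a * f i\<close> and the new index receives \<open>b\<close>,
  where \<open>a * f i + b * prod f I = 1\<close>.\<close>

lemma comaximal_partition_of_unity:
  assumes "finite I" "I \<noteq> {}" "\<And>i j. i \<in> I \<Longrightarrow> j \<in> I \<Longrightarrow> i \<noteq> j \<Longrightarrow> comaximal (f i) (f j)"
  shows "\<exists>u. (\<Sum>i\<in>I. u i * (\<Prod>j\<in>I - {i}. f j)) = 1"
  using assms
proof (induction I rule: finite_ne_induct)
  case (singleton i)
  show ?case by (rule exI[of _ "\<lambda>_. 1"]) simp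
next
  case (insert i I)
  obtain u where u: "(\<Sum>i\<in>I. u i * (\<Prod>j\<in>I - {i}. f j)) = 1" using insert by auto
  have "comaximal (f i) (prod f I)" by (rule comaximal_prod_right) (use insert in auto)
  then obtain a b where ab: "a * f i + b * prod f I = 1" unfolding comaximal_def by blast
  define w where "w j = (if j = i then b else a * u j)" for j
  have *: "(\<Prod>l\<in>insert i I - {j}. f l) = f i * (\<Prod>l\<in>I - {j}. f l)" if "j \<in> I" for j
  proof -
    have "insert i I - {j} = insert i (I - {j})" using that insert by auto
    thus ?thesis using insert by simp
  qed
  have "(\<Sum>j\<in>insert i I. w j * (\<Prod>l\<in>insert i I - {j}. f l))
      = b * prod f I + (\<Sum>j\<in>I. w j * (\<Prod>l\<in>insert i I - {j}. f l))"
    using insert by (simp add: w_def)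
  also have "(\<Sum>j\<in>I. w j * (\<Prod>l\<in>insert i I - {j}. f l))
      = (\<Sum>j\<in>I. a * f i * (u j * (\<Prod>l\<in>I - {j}. f l)))"
    using insert(3) by (intro sum.cong refl) (auto simp: * w_def mult_ac)
  also have "\<dots> = a * f i * 1" unfolding u[symmetric] by (simp add: sum_distrib_left)
  finally show ?case using ab by (auto simp: add.commute)
qed

section \<open>Geometric polynomials over the integers\<close>

definition geo_poly :: "nat \<Rightarrow> int poly" where
  "geo_poly d = (\<Sum>i<d. monom 1 i)"

lemma geo_poly_add: "geo_poly (a + b) = geo_poly a + monom 1 a * geo_poly b"
  unfolding geo_poly_def
  by (induction b) (simp_all add: distrib_left mult_monom)

text \<open>The subtractive Euclidean algorithm on \<open>a\<close> and \<open>b\<close> lifts to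
  polynomials through
  \<open>geo_poly b = geo_poly (b - a) + monom 1 (b - a) * geo_poly a\<close>.\<close>

lemma comaximal_geo_poly:
  assumes "coprime a b"
  shows "comaximal (geo_poly a) (geo_poly b)"
  using assms
proof (induction "a + b" arbitrary: a b rule: less_induct)
  case less
  have step: "comaximal (geo_poly a) (geo_poly b)" if ab: "0 < a" "a \<le> b" "coprime a b"
    and IH: "\<And>a' b'. a' + b' < a + b \<Longrightarrow> coprime a' b' \<Longrightarrow> comaximal (geo_poly a') (geo_poly b')" for a b
  proof -
    have "coprime a (b - a)" using ab by (metis coprime_iff_gcd_eq_1 gcd_diff1_nat gcd.commute)
    hence "comaximal (geo_poly a) (geo_poly (b - a))" using ab by (intro IH) auto
    then obtain u v where uv: "u * geo_poly a + v * geo_poly (b - a) = 1" unfolding comaximal_def by blast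
    have "geo_poly b = geo_poly (b - a) + monom 1 (b - a) * geo_poly a"
      using geo_poly_add[of "b - a" a] ab by simp
    hence "(u - v * monom 1 (b - a)) * geo_poly a + v * geo_poly b = 1"
      using uv by (simp add: algebra_simps)
    thus ?thesis by (rule comaximalI)
  qed
  consider "a = 0" | "b = 0" | "0 < a" "a \<le> b" | "0 < b" "b \<le> a" by linarith
  thus ?case
  proof cases
    case 1
    hence "b = 1" using less.prems by simp
    thus ?thesis by (simp add: geo_poly_def)
  next
    case 2
    hence "a = 1" using less.prems by simp
    thus ?thesis by (subst comaximal_commute) (simp add: geo_poly_def)
  next
    case 3
    show ?thesis by (rule step[OF 3 less.prems less.hyps])
  next
    case 4
    have "coprime b a" using less.prems by (simp add: coprime_commute)
    moreover have "a' + b' < b + a \<Longrightarrow> coprime a' b' \<Longrightarrow> comaximal (geo_poly a') (geo_poly b')" for a' b'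
      using less.hyps[of a' b'] by (simp add: add.commute)
    ultimately have "comaximal (geo_poly b) (geo_poly a)" by (rule step[OF 4])
    thus ?thesis by (simp add: comaximal_commute)
  qed
qed

lemma geo_poly_mult: "(monom 1 1 - 1) * geo_poly d = monom 1 d - 1"
proof (induction d)
  case (Suc d)
  have "geo_poly (Suc d) = geo_poly d + monom 1 d" by (simp add: geo_poly_def)
  thus ?case using Suc by (simp add: algebra_simps mult_monom)
qed (simp add: geo_poly_def)

lemma geo_poly_dvd:
  assumes "d dvd n" shows "geo_poly d dvd geo_poly n"
proof -
  obtain e where "n = d * e" using assms by blast
  moreover have "geo_poly d dvd geo_poly (d * e)" 
    by (induction e) (auto simp: geo_poly_add geo_poly_def[of 0])
  ultimately show ?thesis by simp
qed

lemma geo_poly_monic: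
  assumes "d > 0" shows "lead_coeff (geo_poly d) = 1" "degree (geo_poly d) = d - 1"
proof -
  have c: "coeff (geo_poly d) i = (if i < d then 1 else 0)" for i
    by (simp add: geo_poly_def coeff_sum)
  show "degree (geo_poly d) = d - 1"
    by (rule antisym, rule degree_le) (use assms in \<open>auto simp: c intro!: le_degree\<close>)
  thus "lead_coeff (geo_poly d) = 1" using assms by (simp add: c)
qed

text \<open>The integer polynomial \<open>f\<close> evaluated at the \<open>q\<close>-Frobenius, as an operator on the field.\<close>

definition frob_act :: "nat \<Rightarrow> int poly \<Rightarrow> 'a::field \<Rightarrow> 'a" where
  "frob_act q f \<alpha> = (\<Sum>i\<le>degree f. of_int (coeff f i) * \<alpha> ^ (q ^ i))"

lemma frob_act_altdef:
  assumes "degree f \<le> m"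
  shows "frob_act q f \<alpha> = (\<Sum>i\<le>m. of_int (coeff f i) * \<alpha> ^ (q ^ i))"
  unfolding frob_act_def using assms
  by (intro sum.mono_neutral_left) (auto simp: coeff_eq_0 not_le)

lemma frob_act_add: "frob_act q (f + g) \<alpha> = frob_act q f \<alpha> + frob_act q g \<alpha>"
proof -
  define m where "m = max (degree f) (degree g)"
  have "degree (f + g) \<le> m" "degree f \<le> m" "degree g \<le> m"
    using degree_add_le_max[of f g] by (auto simp: m_def)
  thus ?thesis by (simp add: frob_act_altdef[of _ m] distrib_right sum.distrib)
qed

lemma frob_act_0 [simp]: "frob_act q 0 \<alpha> = 0"
  by (simp add: frob_act_def)

lemma frob_act_1 [simp]: "frob_act q 1 \<alpha> = \<alpha>"
  by (simp add: frob_act_def)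

lemma frob_act_sum: "frob_act q (\<Sum>i\<in>I. f i) \<alpha> = (\<Sum>i\<in>I. frob_act q (f i) \<alpha>)"
  by (induction I rule: infinite_finite_induct) (auto simp: frob_act_add)

lemma frob_act_diff: "frob_act q (f - g) \<alpha> = frob_act q f \<alpha> - frob_act q g \<alpha>"
  using frob_act_add[of q "f - g" g \<alpha>] by simp

lemma frob_act_monom: "frob_act q (monom c i) \<alpha> = of_int c * \<alpha> ^ (q ^ i)"
proof -
  have "frob_act q (monom c i) \<alpha> = (\<Sum>j\<le>i. of_int (coeff (monom c i) j) * \<alpha> ^ (q ^ j))"
    by (rule frob_act_altdef) (rule degree_monom_le)
  also have "\<dots> = (\<Sum>j\<le>i. if j = i then of_int c * \<alpha> ^ (q ^ i) else 0)"
    by (intro sum.cong) auto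
  finally show ?thesis by simp
qed

lemma frob_act_geo_poly: "frob_act q (geo_poly d) \<alpha> = Trace q d 1 \<alpha>"
  by (simp add: geo_poly_def frob_act_sum frob_act_monom Trace_def)

text \<open>The operator is evaluation of a linearized polynomial of degree
  \<open>q ^ degree f\<close>. Monicity of \<open>f\<close> keeps it from vanishing in positive
  characteristic.\<close>

lemma card_frob_act_kernel_le:
  fixes f :: "int poly"
  assumes q: "q > 1" and lc: "lead_coeff f = 1"
  shows "card {\<alpha>::'a::finite_field. frob_act q f \<alpha> = 0} \<le> q ^ degree f"
proof -
  define P :: "'a poly" where "P = (\<Sum>i\<le>degree f. monom (of_int (coeff f i)) (q ^ i))"
  have "coeff P (q ^ degree f) = (\<Sum>i\<le>degree f. if i = degree f then 1 else 0)"
    unfolding P_def coeff_sum using q lc by (intro sum.cong) (auto simp: power_inject_exp)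
  also have "\<dots> = 1" by simp
  finally have "P \<noteq> 0" by auto
  moreover have "degree P \<le> q ^ degree f" unfolding P_def
  proof (rule degree_sum_le)
    fix i assume "i \<in> {..degree f}"
    hence "q ^ i \<le> q ^ degree f" using q by (intro power_increasing) auto
    thus "degree (monom (of_int (coeff f i)) (q ^ i) :: 'a poly) \<le> q ^ degree f"
      using degree_monom_le le_trans by blast
  qed simp
  moreover have "{x. poly P x = 0} = {\<alpha>. frob_act q f \<alpha> = 0}"
    by (simp add: P_def poly_sum poly_monom frob_act_def)
  ultimately show ?thesis using card_poly_roots_bound[of P] by (metis le_trans)
qed

section \<open>The Frobenius operators on a field with \<open>q ^ n\<close> elements\<close>

context
  fixes q n :: nat
  assumes q: "primepow q" and card: "card (UNIV :: 'a::finite_field set) = q ^ n" and n: "n > 0"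
begin

lemma frobenius_add: "(x + y :: 'a) ^ (q ^ i) = x ^ (q ^ i) + y ^ (q ^ i)"
proof -
  from q obtain p k where p: "prime p" "k > 0" "q = p ^ k" by (auto simp: primepow_def)
  have prime: "prime CHAR('a)" by (intro prime_CHAR_semidom finite_imp_CHAR_pos finite)
  have "(\<Sum>x\<in>UNIV. x :: 'a) = (\<Sum>x\<in>UNIV. x + 1)"
    by (rule sum.reindex_bij_witness[of _ "\<lambda>x. x + 1" "\<lambda>x. x - 1"]) auto
  hence "of_nat (card (UNIV :: 'a set)) = (0 :: 'a)"
    by (simp add: sum.distrib)
  hence "CHAR('a) dvd p ^ (k * n)"
    unfolding card p(3) of_nat_eq_0_iff_char_dvd by (simp add: power_mult)
  hence "CHAR('a) = p" using prime p(1) by (metis prime_dvd_power primes_dvd_imp_eq)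
  hence m: "q ^ i = CHAR('a) ^ (k * i)" using p by (simp add: power_mult)
  show ?thesis by (rule freshmans_dream'[OF prime m])
qed

lemma q_gt_1: "q > 1" using primepow_gt_Suc_0[OF q] by simp

lemma frobenius_0: "(0 :: 'a) ^ (q ^ i) = 0" using q_gt_1 by simp

lemma frobenius_of_int: "(of_int c :: 'a) ^ (q ^ i) = of_int c"
proof -
  have nat: "(of_nat m :: 'a) ^ (q ^ i) = of_nat m" for m
    by (induction m) (simp_all add: frobenius_add frobenius_0)
  have neg: "(- x :: 'a) ^ (q ^ i) = - (x ^ (q ^ i))" for x
  proof -
    have "x ^ (q ^ i) + (- x) ^ (q ^ i) = (x + - x) ^ (q ^ i)" by (rule frobenius_add[symmetric])
    also have "\<dots> = 0" unfolding add.right_inverse by (rule frobenius_0)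
    finally show ?thesis by (simp add: eq_neg_iff_add_eq_0 add.commute)
  qed
  show ?thesis by (cases c) (use nat neg in \<open>auto simp flip: of_nat_Suc\<close>)
qed

lemma frob_act_arg_add: "frob_act q f (x + y :: 'a) = frob_act q f x + frob_act q f y"
  by (simp add: frob_act_def frobenius_add distrib_left sum.distrib)

lemma frob_act_arg_0 [simp]: "frob_act q f (0 :: 'a) = 0"
proof -
  have "frob_act q f (0 :: 'a) + 0 = frob_act q f (0 + 0 :: 'a)" by simp
  also have "\<dots> = frob_act q f 0 + frob_act q f 0" by (rule frob_act_arg_add)
  finally show ?thesis unfolding add_left_cancel ..
qed

lemma frob_act_arg_diff: "frob_act q f (x - y :: 'a) = frob_act q f x - frob_act q f y"
  using frob_act_arg_add[of f "x - y" y] by simp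

lemma frob_act_arg_sum: "frob_act q f (\<Sum>i\<in>I. g i :: 'a) = (\<Sum>i\<in>I. frob_act q f (g i))"
  by (induction I rule: infinite_finite_induct) (auto simp: frob_act_arg_add)

text \<open>Composition matches multiplication because integer coefficients land in the prime field,
  which the Frobenius fixes.\<close>

lemma frob_act_mult: "frob_act q (f * g) (\<alpha> :: 'a) = frob_act q f (frob_act q g \<alpha>)"
proof -
  have sum_pow: "(\<Sum>i\<in>I. h i :: 'a) ^ (q ^ j) = (\<Sum>i\<in>I. h i ^ (q ^ j))" for I h j
    by (induction I rule: infinite_finite_induct) (auto simp: frobenius_add frobenius_0)
  have "frob_act q (f * g) \<alpha> = frob_act q ((\<Sum>i\<le>degree f. monom (coeff f i) i) * (\<Sum>j\<le>degree g. monom (coeff g j) j)) \<alpha>"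
    by (simp add: poly_as_sum_of_monoms)
  also have "\<dots> = (\<Sum>i\<le>degree f. \<Sum>j\<le>degree g. of_int (coeff f i * coeff g j) * \<alpha> ^ (q ^ (i + j)))"
    by (simp add: sum_product frob_act_sum mult_monom frob_act_monom)
  also have "\<dots> = (\<Sum>i\<le>degree f. of_int (coeff f i) * (\<Sum>j\<le>degree g. (of_int (coeff g j) * \<alpha> ^ (q ^ j)) ^ (q ^ i)))"
    by (simp add: sum_distrib_left power_mult_distrib frobenius_of_int power_add power_mult mult_ac
        flip: power_mult)
  also have "\<dots> = frob_act q f (frob_act q g \<alpha>)"
    unfolding frob_act_def[of q f] frob_act_def[of q g] sum_pow ..
  finally show ?thesis .
qed

lemma frob_act_period: "frob_act q (monom 1 n - 1) (\<alpha> :: 'a) = 0"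
proof -
  have "\<alpha> ^ (q ^ n) = \<alpha>"
    using finite_field_power_card_eq_same[of \<alpha>] unfolding card .
  thus ?thesis by (simp add: frob_act_diff frob_act_monom)
qed

text \<open>A pure count: the image lies in the kernel of \<open>H\<close> and the fibres are no
  larger than the kernel of \<open>G\<close>. The degree bounds on the two kernels multiply to
  \<open>q ^ n\<close>, so every inequality is an equality.\<close>

lemma frob_act_kernel_image:
  assumes GH: "G * H = monom 1 n - 1" and lc: "lead_coeff G = 1" "lead_coeff H = 1"
  shows "range (frob_act q G :: 'a \<Rightarrow> 'a) = {\<beta>. frob_act q H \<beta> = 0}"
    and "card {\<alpha>::'a. frob_act q G \<alpha> = 0} = q ^ degree G"
proof -
  let ?K = "{\<alpha>::'a. frob_act q G \<alpha> = 0}" and ?L = "{\<beta>::'a. frob_act q H \<beta> = 0}"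
  have "G \<noteq> 0" "H \<noteq> 0" using lc by auto
  hence deg: "degree G + degree H = n"
  proof -
    have "degree (monom 1 n - 1 :: int poly) = n"
    proof (rule antisym)
      show "degree (monom 1 n - 1 :: int poly) \<le> n"
        by (rule degree_diff_le) (auto simp: degree_monom_eq)
      show "n \<le> degree (monom 1 n - 1 :: int poly)" using n by (intro le_degree) simp
    qed
    thus ?thesis using GH \<open>G \<noteq> 0\<close> \<open>H \<noteq> 0\<close> degree_mult_eq by metis
  qed
  have sub: "range (frob_act q G :: 'a \<Rightarrow> 'a) \<subseteq> ?L"
  proof safe
    fix \<alpha> :: 'a
    have "frob_act q (H * G) \<alpha> = 0" using GH frob_act_period by (simp add: mult.commute)
    thus "frob_act q H (frob_act q G \<alpha>) = 0" by (simp add: frob_act_mult)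
  qed
  have fibre: "card {\<alpha>::'a. frob_act q G \<alpha> = \<beta>} \<le> card ?K" for \<beta>
  proof (cases "\<exists>\<gamma>. frob_act q G \<gamma> = \<beta>")
    case True
    then obtain \<gamma> where \<gamma>: "frob_act q G \<gamma> = \<beta>" by blast
    have "(\<lambda>\<alpha>. \<alpha> - \<gamma>) ` {\<alpha>. frob_act q G \<alpha> = \<beta>} \<subseteq> ?K"
      using \<gamma> by (auto simp: frob_act_arg_diff)
    thus ?thesis using card_inj_on_le[of "\<lambda>\<alpha>. \<alpha> - \<gamma>" "{\<alpha>. frob_act q G \<alpha> = \<beta>}" ?K] by (simp add: inj_on_def)
  next
    case False
    hence "{\<alpha>. frob_act q G \<alpha> = \<beta>} = {}" by blast
    thus ?thesis by simp
  qed
  have K: "card ?K \<le> q ^ degree G" and L: "card ?L \<le> q ^ degree H"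
    using card_frob_act_kernel_le[OF q_gt_1] lc by auto
  have "card (UNIV :: 'a set) \<le> card (\<Union>\<beta>\<in>range (frob_act q G :: 'a \<Rightarrow> 'a). {\<alpha>. frob_act q G \<alpha> = \<beta>})"
    by (intro card_mono) auto
  also have "\<dots> \<le> (\<Sum>\<beta>\<in>range (frob_act q G :: 'a \<Rightarrow> 'a). card {\<alpha>. frob_act q G \<alpha> = \<beta>})"
    by (rule card_UN_le) simp
  also have "\<dots> \<le> card (range (frob_act q G :: 'a \<Rightarrow> 'a)) * card ?K"
    using sum_bounded_above[of "range (frob_act q G :: 'a \<Rightarrow> 'a)", OF fibre] by simp
  finally have all: "q ^ degree G * q ^ degree H \<le> card (range (frob_act q G :: 'a \<Rightarrow> 'a)) * card ?K"
    using deg card by (simp flip: power_add)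
  have RL: "card (range (frob_act q G :: 'a \<Rightarrow> 'a)) \<le> card ?L" by (rule card_mono[OF _ sub]) simp
  have q0: "q > 0" using q_gt_1 by simp
  have "q ^ degree G * q ^ degree H \<le> card ?L * q ^ degree G"
    using all mult_le_mono[OF RL K] by linarith
  hence "q ^ degree H \<le> card ?L" using q0 by (simp add: mult.commute)
  have "q ^ degree G * q ^ degree H \<le> card (range (frob_act q G :: 'a \<Rightarrow> 'a)) * q ^ degree G"
    using all mult_le_mono[OF order_refl K] le_trans by blast
  hence "q ^ degree H \<le> card (range (frob_act q G :: 'a \<Rightarrow> 'a))" using q0 by (simp add: mult.commute)
  thus "range (frob_act q G :: 'a \<Rightarrow> 'a) = ?L" using L sub RL by (intro card_subset_eq) auto
  have "q ^ degree G * q ^ degree H \<le> q ^ degree H * card ?K"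
    using all mult_le_mono[OF le_trans[OF RL L] order_refl, of "card ?K"] by linarith
  hence "q ^ degree G \<le> card ?K" using q0 by (simp add: mult.commute)
  thus "card ?K = q ^ degree G" using K by simp
qed

text \<open>
  With \<open>Q i\<close> the product of the \<open>\<Psi> j\<close> over \<open>j \<noteq> i\<close>, the trace onto the \<open>i\<close>-th subfield is the operator of
  \<open>G * Q i\<close>. From \<open>(\<Sum>i. u i * Q i) = 1\<close> and \<open>Q j (a i) = Q i (a j)\<close>, which is admissibility, the element
  \<open>\<beta> = (\<Sum>i. u i (a i))\<close> satisfies \<open>Q i \<beta> = a i\<close>, and it remains to solve \<open>G c = \<beta>\<close>.
\<close>

lemma trace_coset:
  fixes d :: "'i \<Rightarrow> nat" and a :: "'i \<Rightarrow> 'a"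
  assumes I: "finite I" "I \<noteq> {}"
    and d: "\<And>i. i \<in> I \<Longrightarrow> d i dvd n"
    and cop: "\<And>i j. i \<in> I \<Longrightarrow> j \<in> I \<Longrightarrow> i \<noteq> j \<Longrightarrow> coprime (d i) (d j)"
    and a: "\<And>i. i \<in> I \<Longrightarrow> a i ^ (q ^ d i) = a i"
    and adm: "\<And>i j. i \<in> I \<Longrightarrow> j \<in> I \<Longrightarrow> i \<noteq> j \<Longrightarrow> Trace q (d i) 1 (a i) = Trace q (d j) 1 (a j)"
  defines "l \<equiv> 1 + (\<Sum>i\<in>I. d i - 1)"
  obtains c V where "0 \<in> V" "\<And>x y. x \<in> V \<Longrightarrow> y \<in> V \<Longrightarrow> x - y \<in> V"
    "card V = q ^ (n - l)" "\<And>v i. v \<in> V \<Longrightarrow> i \<in> I \<Longrightarrow> Trace q n (d i) (c + v) = a i"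
proof -
  have d0: "d i > 0" if "i \<in> I" for i using d[OF that] n by (auto intro: gr0I)
  define X1 :: "int poly" where "X1 = monom 1 1 - 1"
  define \<Psi> where "\<Psi> i = geo_poly (d i)" for i
  define P where "P = (\<Prod>i\<in>I. \<Psi> i)"
  define Q where "Q i = (\<Prod>j\<in>I - {i}. \<Psi> j)" for i
  have comaximal: "comaximal (\<Psi> i) (\<Psi> j)" if "i \<in> I" "j \<in> I" "i \<noteq> j" for i j
    unfolding \<Psi>_def by (intro comaximal_geo_poly cop that)
  have PQ: "P = \<Psi> i * Q i" if "i \<in> I" for i
    unfolding P_def Q_def using I that by (intro prod.remove) auto
  have "P dvd geo_poly n" unfolding P_def
    by (rule comaximal_prod_dvd[OF I(1) comaximal]) (auto simp: \<Psi>_def intro: geo_poly_dvd d)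
  then obtain G where G: "geo_poly n = P * G" by blast
  define H where "H = X1 * P"
  have GH: "G * H = monom 1 n - 1"
    using geo_poly_mult[of n] by (simp add: H_def G X1_def mult_ac)
  have X1: "lead_coeff X1 = 1" "degree X1 = 1"
  proof -
    show "degree X1 = 1"
      unfolding X1_def by (rule antisym) (auto intro!: degree_diff_le le_degree simp: degree_monom_eq)
    thus "lead_coeff X1 = 1" by (simp add: X1_def)
  qed
  have lcP: "lead_coeff P = 1" unfolding P_def lead_coeff_prod
    by (rule prod.neutral) (use geo_poly_monic(1) d0 in \<open>auto simp: \<Psi>_def\<close>)
  have degP: "degree P = (\<Sum>i\<in>I. d i - 1)"
  proof -
    have "\<Psi> i \<noteq> 0" if "i \<in> I" for i using geo_poly_monic(1)[OF d0[OF that]] by (auto simp: \<Psi>_def)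
    hence "degree P = (\<Sum>i\<in>I. degree (\<Psi> i))"
      unfolding P_def by (intro degree_prod_eq_sum_degree) auto
    also have "\<dots> = (\<Sum>i\<in>I. d i - 1)" by (intro sum.cong) (auto simp: \<Psi>_def geo_poly_monic d0)
    finally show ?thesis .
  qed
  have lcG: "lead_coeff G = 1"
    using G lcP geo_poly_monic(1)[OF n] by (simp add: lead_coeff_mult)
  have lcH: "lead_coeff H = 1" using lcP X1 by (simp add: H_def lead_coeff_mult)
  have nz: "P \<noteq> 0" "G \<noteq> 0" "X1 \<noteq> 0" using lcP lcG X1 by auto
  have degG: "degree G = n - l"
  proof -
    have "degree G + (\<Sum>i\<in>I. d i - 1) = n - 1"
      using geo_poly_monic(2)[OF n] nz degP by (simp add: G degree_mult_eq add.commute)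
    thus ?thesis using n by (simp add: l_def)
  qed
  \<comment> \<open>Both the trace polynomial \<open>T\<close> and \<open>G * Q i\<close> become
    \<open>x ^ n - 1\<close> after multiplication by \<open>x ^ d i - 1\<close>, which can be
    cancelled.\<close>
  have trace: "Trace q n (d i) x = frob_act q (G * Q i) x" if i: "i \<in> I" for i and x :: 'a
  proof -
    obtain e where e: "n = d i * e" using d[OF i] by blast
    define T :: "int poly" where "T = (\<Sum>t<e. monom 1 (d i * t))"
    have "(monom 1 (d i) - 1) * T = monom 1 n - 1"
    proof -
      have "(monom 1 (d i) - 1) * (\<Sum>t<m. monom 1 (d i * t)) = (monom 1 (d i * m) - 1 :: int poly)" for m
        by (induction m) (auto simp: algebra_simps mult_monom)
      thus ?thesis by (simp add: T_def e)
    qed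
    moreover have "(monom 1 (d i) - 1) * (G * Q i) = monom 1 n - 1"
      unfolding GH[symmetric] geo_poly_mult[of "d i", symmetric] by (simp add: H_def PQ[OF i] X1_def \<Psi>_def mult_ac)
    moreover have "(monom 1 (d i) - 1 :: int poly) \<noteq> 0"
      unfolding geo_poly_mult[of "d i", symmetric] X1_def[symmetric] using nz(3) geo_poly_monic(1)[OF d0[OF i]] by auto
    ultimately have "T = G * Q i" by (metis mult_left_cancel)
    moreover have "frob_act q T x = Trace q n (d i) x"
      using d0[OF i] by (simp add: T_def frob_act_sum frob_act_monom Trace_def e)
    ultimately show ?thesis by simp
  qed
  have "\<exists>u. (\<Sum>i\<in>I. u i * Q i) = 1"
    unfolding Q_def by (rule comaximal_partition_of_unity[OF I comaximal])
  then obtain u where u: "(\<Sum>i\<in>I. u i * Q i) = 1" ..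
  define \<beta> where "\<beta> = (\<Sum>i\<in>I. frob_act q (u i) (a i))"
  \<comment> \<open>Both sides apply the product of the remaining \<open>\<Psi> l\<close> to the
    trace onto the base field, of \<open>a i\<close> on the left and of \<open>a j\<close> on the
    right.\<close>
  have Qa: "frob_act q (Q j) (a i) = frob_act q (Q i) (a j)" if ij: "i \<in> I" "j \<in> I" for i j
  proof (cases "i = j")
    case False
    define R where "R = (\<Prod>l\<in>I - {i, j}. \<Psi> l)"
    have sets: "I - {j} - {i} = I - {i, j}" "I - {i} - {j} = I - {i, j}" by auto
    have *: "Q j = R * \<Psi> i" "Q i = R * \<Psi> j"
      using prod.remove[of "I - {j}" i \<Psi>] prod.remove[of "I - {i}" j \<Psi>] I(1) ij False
      unfolding Q_def R_def sets by (simp_all add: mult.commute)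
    show ?thesis
      using adm[OF ij False] by (simp add: * frob_act_mult \<Psi>_def frob_act_geo_poly)
  qed simp
  have Q\<beta>: "frob_act q (Q j) \<beta> = a j" if j: "j \<in> I" for j
  proof -
    have "frob_act q (Q j) \<beta> = (\<Sum>i\<in>I. frob_act q (u i) (frob_act q (Q j) (a i)))"
      unfolding \<beta>_def frob_act_arg_sum frob_act_mult[symmetric] by (simp only: mult.commute)
    also have "\<dots> = (\<Sum>i\<in>I. frob_act q (u i * Q i) (a j))"
      using j by (intro sum.cong) (auto simp: Qa frob_act_mult)
    also have "\<dots> = a j" unfolding frob_act_sum[symmetric] u by simp
    finally show ?thesis .
  qed
  \<comment> \<open>\<open>H\<close> factors as \<open>(x ^ d j - 1) * Q j\<close>, and
    \<open>Q j\<close> sends \<open>\<beta>\<close> to \<open>a j\<close>, which is fixed by the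
    power \<open>d j\<close> of the Frobenius.\<close>
  have "frob_act q H \<beta> = 0"
  proof -
    obtain j where j: "j \<in> I" using I(2) by blast
    have "H = (monom 1 (d j) - 1) * Q j"
      unfolding geo_poly_mult[of "d j", symmetric] by (simp add: H_def PQ[OF j] X1_def \<Psi>_def mult_ac)
    thus ?thesis using Q\<beta>[OF j] a[OF j] by (simp add: frob_act_mult frob_act_diff frob_act_monom)
  qed
  then obtain c where c: "frob_act q G c = \<beta>"
    using frob_act_kernel_image(1)[OF GH lcG lcH] by (metis (mono_tags, lifting) imageE mem_Collect_eq)
  show ?thesis
  proof (rule that[of "{\<alpha>. frob_act q G \<alpha> = 0}" c])
    show "card {\<alpha>::'a. frob_act q G \<alpha> = 0} = q ^ (n - l)"
      using frob_act_kernel_image(2)[OF GH lcG lcH] degG by simp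
    fix v i assume v: "v \<in> {\<alpha>::'a. frob_act q G \<alpha> = 0}" and i: "i \<in> I"
    have "Trace q n (d i) (c + v) = frob_act q (Q i) (frob_act q G (c + v))"
      unfolding trace[OF i] frob_act_mult[symmetric] by (simp only: mult.commute)
    thus "Trace q n (d i) (c + v) = a i" using v c Q\<beta>[OF i] by (simp add: frob_act_arg_add)
  qed (auto simp: frob_act_arg_diff)
qed

end

subsection \<open>The sieve condition\<close>

text \<open>
  The numerical hypothesis of \<open>primitive_element_in_coset\<close> with \<open>M = q ^ n - 1\<close>, divided by
  \<open>sqrt (q ^ n)\<close>; thus \<open>x\<close> stands for \<open>q ^ (n / 2 - \<lambda>)\<close>.
\<close>

definition sieve_ok :: "nat \<Rightarrow> real \<Rightarrow> bool" where
  "sieve_ok M x \<longleftrightarrow> (\<exists>S T. finite S \<and> finite T \<and> S \<inter> T = {} \<and> S \<union> T = {p. prime p \<and> p dvd M} \<and>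
     (\<Sum>p\<in>T. 1 / real p) < 1 \<and>
     2 ^ card S * ((real (card T) - 1) / (1 - (\<Sum>p\<in>T. 1 / real p)) + 2) \<le> x)"

text \<open>Writing \<open>n = E + 2 * \<lambda>\<close> additively includes
  \<open>2 * \<lambda> \<le> n\<close>, so no truncated subtraction enters the size of the
  coset.\<close>

lemma primitive_element_with_traces:
  fixes d :: "'i \<Rightarrow> nat" and a :: "'i \<Rightarrow> 'a::finite_field"
  assumes q: "primepow q" and card: "card (UNIV :: 'a set) = q ^ n" and n: "n > 0"
    and I: "finite I" "I \<noteq> {}"
    and d: "\<And>i. i \<in> I \<Longrightarrow> d i dvd n"
    and cop: "\<And>i j. i \<in> I \<Longrightarrow> j \<in> I \<Longrightarrow> i \<noteq> j \<Longrightarrow> coprime (d i) (d j)"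
    and a: "\<And>i. i \<in> I \<Longrightarrow> a i ^ (q ^ d i) = a i"
    and adm: "\<And>i j. i \<in> I \<Longrightarrow> j \<in> I \<Longrightarrow> i \<noteq> j \<Longrightarrow> Trace q (d i) 1 (a i) = Trace q (d j) 1 (a j)"
    and E: "n = E + 2 * (1 + (\<Sum>i\<in>I. d i - 1))"
    and ok: "sieve_ok (q ^ n - 1) (sqrt (real (q ^ E)))"
  shows "\<exists>\<alpha>::'a. primitive_element \<alpha> \<and> (\<forall>i\<in>I. Trace q n (d i) \<alpha> = a i)"
proof -
  define l where "l = 1 + (\<Sum>i\<in>I. d i - 1)"
  obtain c :: 'a and V where V: "0 \<in> V" "\<And>x y. x \<in> V \<Longrightarrow> y \<in> V \<Longrightarrow> x - y \<in> V"
    "card V = q ^ (n - l)" "\<And>v i. v \<in> V \<Longrightarrow> i \<in> I \<Longrightarrow> Trace q n (d i) (c + v) = a i"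
    unfolding l_def by (rule trace_coset[where I = I and d = d and a = a, OF q card n I d cop a adm]) (assumption+, rule that[unfolded l_def])
  obtain S T where ST: "finite S" "finite T" "S \<inter> T = {}" "S \<union> T = {p. prime p \<and> p dvd q ^ n - 1}"
    "(\<Sum>p\<in>T. 1 / real p) < 1"
    "2 ^ card S * ((real (card T) - 1) / (1 - (\<Sum>p\<in>T. 1 / real p)) + 2) \<le> sqrt (real (q ^ E))"
    using ok unfolding sieve_ok_def by (elim exE conjE) (rule that)
  have "\<exists>v\<in>V. primitive_element (c + v)"
  proof (rule primitive_element_in_coset[OF ST(1,2,3) _ V(1,2) refl])
    show "S \<union> T = {p. prime p \<and> p dvd card (UNIV :: 'a set) - 1}" using ST(4) card by simp
    have "2 * (n - l) = E + n" using E unfolding l_def by simp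
    hence "real (card V) ^ 2 = real (q ^ E) * real (q ^ n)"
      unfolding V(3) by (simp flip: power_add power_mult add: mult.commute)
    hence "real (card V) = sqrt (real (q ^ E) * real (q ^ n))"
      by (metis of_nat_0_le_iff real_sqrt_unique)
    also have "\<dots> = sqrt (real (q ^ n)) * sqrt (real (q ^ E))" by (simp add: real_sqrt_mult)
    finally have "real (card V) = sqrt (real (q ^ n)) * sqrt (real (q ^ E))" .
    thus "sqrt (real (card (UNIV :: 'a set))) * (2 ^ card S * ((real (card T) - 1) / (1 - (\<Sum>p\<in>T. 1 / real p)) + 2)) \<le> real (card V)"
      using ST(6) unfolding card by (simp add: mult_left_mono)
    show "0 < 1 - (\<Sum>p\<in>T. 1 / real p)" using ST(5) by (subst diff_gt_0_iff_gt)
  qed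
  thus ?thesis using V(4) by blast
qed

section \<open>Counting prime divisors and summing their reciprocals\<close>

lemma prod_coprime_dvd:
  fixes f :: "'i \<Rightarrow> nat"
  assumes "finite I" "\<And>i j. i \<in> I \<Longrightarrow> j \<in> I \<Longrightarrow> i \<noteq> j \<Longrightarrow> coprime (f i) (f j)" "\<And>i. i \<in> I \<Longrightarrow> f i dvd m"
  shows "(\<Prod>i\<in>I. f i) dvd m"
  using assms
proof (induction I rule: finite_induct)
  case (insert i I)
  have "coprime (f i) (prod f I)"
    by (rule prod_coprime_right) (use insert in auto)
  thus ?case using insert by (auto intro: divides_mult)
qed auto

lemma prod_primes_dvd:
  fixes M :: nat
  assumes "finite A" "\<And>p. p \<in> A \<Longrightarrow> prime p \<and> p dvd M"
  shows "\<Prod>A dvd M"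
  using assms by (intro prod_coprime_dvd) (auto intro!: primes_coprime)

text \<open>
  In the product of \<open>c / p\<close> over \<open>T\<close> only the factors with \<open>p < c\<close> exceed 1; this bounds the number of
  primes in \<open>T\<close> by the logarithm of their product to base \<open>c\<close>, up to a constant depending on \<open>c\<close>.
\<close>

lemma tilted_prod_bound:
  fixes c :: nat
  assumes "finite T" "finite A" and T: "\<And>p. p \<in> T \<Longrightarrow> p \<in> A \<or> c \<le> p" and A: "\<And>p. p \<in> A \<Longrightarrow> p \<le> c"
  shows "c ^ card T * \<Prod>A \<le> \<Prod>T * c ^ card A"
proof -
  have T': "T = (T \<inter> A) \<union> (T - A)" and A': "A = (T \<inter> A) \<union> (A - T)" by auto
  have "c ^ card (T - A) \<le> \<Prod>(T - A)"
    using prod_mono[of "T - A" "\<lambda>_. c" "\<lambda>p. p"] T by auto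
  moreover have "\<Prod>(A - T) \<le> c ^ card (A - T)"
    using prod_mono[of "A - T" "\<lambda>p. p" "\<lambda>_. c"] A by auto
  ultimately have "c ^ card (T \<inter> A) * \<Prod>(T \<inter> A) * (c ^ card (T - A) * \<Prod>(A - T))
      \<le> c ^ card (T \<inter> A) * \<Prod>(T \<inter> A) * (\<Prod>(T - A) * c ^ card (A - T))"
    by (intro mult_le_mono) auto
  moreover have "card T = card (T \<inter> A) + card (T - A)" "card A = card (T \<inter> A) + card (A - T)"
    using assms(1,2) by (subst T' A', subst card_Un_disjoint; auto)+
  moreover have "\<Prod>T = \<Prod>(T \<inter> A) * \<Prod>(T - A)" "\<Prod>A = \<Prod>(T \<inter> A) * \<Prod>(A - T)"
    using assms(1,2) by (subst T' A', subst prod.union_disjoint; auto)+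
  ultimately show ?thesis by (simp add: power_add mult_ac)
qed

text \<open>After subtracting \<open>1 / c\<close> from each reciprocal, elements outside
  \<open>A\<close> contribute at most 0 and those of \<open>A\<close> at least 0. The worst case is
  therefore that all of \<open>A\<close> occurs.\<close>

lemma tilted_sum_bound:
  fixes c :: nat
  assumes "finite T" "finite A" and T: "\<And>p. p \<in> T \<Longrightarrow> p \<in> A \<or> c \<le> p"
    and A: "\<And>p. p \<in> A \<Longrightarrow> 0 < p \<and> p \<le> c" and c: "c > 0"
  shows "(\<Sum>p\<in>T. 1 / real p) \<le> card T / c + (\<Sum>p\<in>A. 1 / real p - 1 / c)"
proof -
  have "(\<Sum>p\<in>T. 1 / real p - 1 / c) \<le> (\<Sum>p\<in>T \<inter> A. 1 / real p - 1 / c)"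
  proof (rule ord_le_eq_trans)
    show "(\<Sum>p\<in>T. 1 / real p - 1 / c) \<le> (\<Sum>p\<in>T. if p \<in> A then 1 / real p - 1 / c else 0)"
    proof (rule sum_mono)
      fix p assume "p \<in> T"
      show "1 / real p - 1 / c \<le> (if p \<in> A then 1 / real p - 1 / c else 0)"
        using T[OF \<open>p \<in> T\<close>] c by (auto intro!: frac_le)
    qed
    show "(\<Sum>p\<in>T. if p \<in> A then 1 / real p - 1 / c else 0) = (\<Sum>p\<in>T \<inter> A. 1 / real p - 1 / c)"
      using assms(1) by (simp add: sum.inter_restrict)
  qed
  also have "\<dots> \<le> (\<Sum>p\<in>A. 1 / real p - 1 / c)"
    using assms(2) A by (intro sum_mono2) (auto simp: frac_le)
  finally show ?thesis using c by (simp add: sum_subtractf)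
qed

text \<open>The condition \<open>1 \<le> s0\<close> keeps the larger numerator nonnegative, so that
  \<open>s = 0\<close> is covered as well.\<close>

lemma sieve_bound_mono:
  fixes s w s0 w0 :: nat and \<sigma> \<delta> :: real
  assumes "s \<le> s0" "1 \<le> s0" "w \<le> w0" "\<sigma> \<le> \<delta>" "\<delta> < 1"
  shows "2 ^ w * ((real s - 1) / (1 - \<sigma>) + 2) \<le> 2 ^ w0 * ((real s0 - 1) / (1 - \<delta>) + 2)"
proof -
  have *: "(real s - 1) / (1 - \<sigma>) \<le> (real s0 - 1) / (1 - \<delta>)"
    using assms by (intro frac_le) auto
  have "2 ^ w * ((real s - 1) / (1 - \<sigma>) + 2) \<le> 2 ^ w * ((real s0 - 1) / (1 - \<delta>) + 2)"
    using * by (intro mult_left_mono) auto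
  also have "\<dots> \<le> 2 ^ w0 * ((real s0 - 1) / (1 - \<delta>) + 2)"
    using assms by (intro mult_right_mono power_increasing) (auto intro!: add_nonneg_nonneg divide_nonneg_nonneg)
  finally show ?thesis .
qed

section \<open>Splitting the prime divisors at 11\<close>

text \<open>The reciprocals of 2, 3, 5, 7 add up to more than 1, so these primes cannot all be
  sieved linearly. They go to the character part, at the price of a factor 2 each.\<close>

definition small_primes :: "nat \<Rightarrow> nat set" where
  "small_primes M = {p. prime p \<and> p dvd M \<and> p < 11}"

definition large_primes :: "nat \<Rightarrow> nat set" where
  "large_primes M = {p. prime p \<and> p dvd M \<and> 11 \<le> p}"

lemma finite_large_primes: "M > 0 \<Longrightarrow> finite (large_primes M)"
  by (rule finite_subset[of _ "{..M}"]) (auto simp: large_primes_def dvd_imp_le)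

lemma prime_less_11:
  assumes "prime p" "p < (11 :: nat)" shows "p \<in> {2, 3, 5, 7}"
proof -
  have "2 dvd p \<Longrightarrow> p = 2" "3 dvd p \<Longrightarrow> p = 3" using assms(1) prime_nat_iff by force+
  moreover have "p = 2 \<or> p = 3 \<or> p = 4 \<or> p = 5 \<or> p = 6 \<or> p = 7 \<or> p = 8 \<or> p = 9 \<or> p = 10"
    using assms(2) prime_ge_2_nat[OF assms(1)] by linarith
  ultimately show ?thesis by auto
qed

lemma small_primes_subset: "small_primes M \<subseteq> {2, 3, 5, 7}"
  using prime_less_11 by (auto simp: small_primes_def)

lemma card_small_primes: "card (small_primes M) \<le> 4"
  using card_mono[OF _ small_primes_subset[of M]] by simp

lemma sieve_ok_large_primes:
  fixes c :: nat
  assumes M: "M > 0" and s: "card (large_primes M) \<le> s0" "1 \<le> s0" and w: "card (small_primes M) \<le> w0"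
    and A: "finite A" "\<And>p. p \<in> A \<Longrightarrow> 0 < p \<and> p \<le> c" "c > 0"
      "\<And>p. p \<in> large_primes M \<Longrightarrow> p \<in> A \<or> c \<le> p"
    and \<delta>: "s0 / c + (\<Sum>p\<in>A. 1 / real p - 1 / c) \<le> \<delta>" "\<delta> < 1"
    and x: "2 ^ w0 * ((real s0 - 1) / (1 - \<delta>) + 2) \<le> x"
  shows "sieve_ok M x"
proof -
  let ?S = "small_primes M" and ?T = "large_primes M"
  have fin: "finite ?S" "finite ?T"
    using finite_subset[OF small_primes_subset] finite_large_primes[OF M] by auto
  have "card ?T / c \<le> s0 / c" using s A(3) by (intro divide_right_mono) auto
  hence sum: "(\<Sum>p\<in>?T. 1 / real p) \<le> \<delta>"
    using tilted_sum_bound[OF fin(2) A(1,4,2,3)] \<delta>(1) by linarith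
  have "2 ^ card ?S * ((real (card ?T) - 1) / (1 - (\<Sum>p\<in>?T. 1 / real p)) + 2) \<le> x"
    using sieve_bound_mono[OF s w sum \<delta>(2)] x by linarith
  thus ?thesis unfolding sieve_ok_def using fin sum \<delta>(2)
    by (intro exI[of _ ?S] exI[of _ ?T]) (auto simp: small_primes_def large_primes_def)
qed

text \<open>The product of the small primes is kept on the left: when many of them divide
  \<open>M\<close>, less room remains for large ones.\<close>

lemma large_primes_prod_bound:
  assumes M: "M > 0" and A: "finite A" "\<And>p. p \<in> A \<Longrightarrow> p \<le> c"
      "\<And>p. p \<in> large_primes M \<Longrightarrow> p \<in> A \<or> c \<le> p"
  shows "c ^ card (large_primes M) * \<Prod>A * \<Prod>(small_primes M) \<le> M * c ^ card A"
proof -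
  let ?S = "small_primes M" and ?T = "large_primes M"
  have fin: "finite ?S" "finite ?T"
    using finite_subset[OF small_primes_subset] finite_large_primes[OF M] by auto
  have "c ^ card ?T * \<Prod>A \<le> \<Prod>?T * c ^ card A"
    by (rule tilted_prod_bound[OF fin(2) A(1,3,2)])
  hence "c ^ card ?T * \<Prod>A * \<Prod>?S \<le> \<Prod>?T * \<Prod>?S * c ^ card A" by (simp add: mult_ac)
  also have "\<Prod>?T * \<Prod>?S = \<Prod>(?T \<union> ?S)"
    using fin by (subst prod.union_disjoint) (auto simp: small_primes_def large_primes_def)
  also have "\<dots> \<le> M"
    using fin M by (intro dvd_imp_le prod_primes_dvd) (auto simp: small_primes_def large_primes_def)
  finally show ?thesis by simp
qed

text \<open>The cutoffs are powers of two, so that bounds on the number of large primes become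
  comparisons of exponents of 2.\<close>

definition primes_11_32 :: "nat set" where "primes_11_32 = {11, 13, 17, 19, 23, 29, 31}"
definition primes_11_64 :: "nat set" where "primes_11_64 = primes_11_32 \<union> {37, 41, 43, 47, 53, 59, 61}"
definition primes_11_128 :: "nat set" where
  "primes_11_128 = primes_11_64 \<union> {67, 71, 73, 79, 83, 89, 97, 101, 103, 107, 109, 113, 127}"

text \<open>Trial division only by primes below \<open>m\<close> ensures that no trial divisor
  equals \<open>p\<close> itself.\<close>

lemma prime_cases_sieve:
  fixes p c :: nat
  assumes "prime p" "m \<le> p" "p < c" "m > 1"
  shows "p \<in> set (filter (\<lambda>p. \<forall>r\<in>{2, 3, 5, 7, 11, 13}. r < m \<longrightarrow> \<not> r dvd p) [m..<c])"
proof -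
  have "\<not> r dvd p" if "r \<in> {2, 3, 5, 7, 11, 13}" "r < m" for r
  proof
    assume "r dvd p"
    moreover have "r \<noteq> 1" "r \<noteq> p" using that assms by auto
    ultimately show False using assms(1) by (meson prime_nat_iff)
  qed
  thus ?thesis using assms(2,3) by simp
qed

lemma large_primes_cases:
  assumes "p \<in> large_primes M"
  shows "p \<in> primes_11_32 \<or> 32 \<le> p" "p \<in> primes_11_64 \<or> 64 \<le> p" "p \<in> primes_11_128 \<or> 128 \<le> p"
proof -
  have p: "prime p" "11 \<le> p" using assms by (auto simp: large_primes_def)
  \<comment> \<open>The only composite between 11 and 127 that survives trial division by 2, 3, 5,
    7; the next one is 143.\<close>
  have "p \<noteq> 121" using p(1) prime_product[of 11 11] by auto
  show "p \<in> primes_11_128 \<or> 128 \<le> p"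
  proof (cases "p < 128")
    case True
    have "p \<in> primes_11_128"
      using prime_cases_sieve[OF p True] \<open>p \<noteq> 121\<close>
      by (simp add: upt_rec_numeral primes_11_128_def primes_11_64_def primes_11_32_def) (elim disjE; simp)
    thus ?thesis ..
  qed simp
  thus "p \<in> primes_11_64 \<or> 64 \<le> p" "p \<in> primes_11_32 \<or> 32 \<le> p" by (auto simp: primes_11_128_def primes_11_64_def primes_11_32_def)
qed

lemma primes_11_facts:
  "finite primes_11_32" "finite primes_11_64" "finite primes_11_128"
  "card primes_11_32 = 7" "card primes_11_64 = 14" "card primes_11_128 = 27"
  by (simp_all add: primes_11_128_def primes_11_64_def primes_11_32_def)

lemma primes_11_range:
  "p \<in> primes_11_32 \<Longrightarrow> 0 < p \<and> p \<le> 32" "p \<in> primes_11_64 \<Longrightarrow> 0 < p \<and> p \<le> 64" "p \<in> primes_11_128 \<Longrightarrow> 0 < p \<and> p \<le> 128"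
  by (auto simp: primes_11_128_def primes_11_64_def primes_11_32_def)

lemma primes_11_sums:
  "(\<Sum>p\<in>primes_11_32. 1 / real p - 1 / real 32) \<le> 0.1708"
  "(\<Sum>p\<in>primes_11_64. 1 / real p - 1 / real 64) \<le> 0.319"
  "(\<Sum>p\<in>primes_11_128. 1 / real p - 1 / real 128) \<le> 0.4706"
proof -
  have "(\<Sum>p\<in>primes_11_32. 1 / real p) \<le> 0.1708 + 7 / 32" "(\<Sum>p\<in>primes_11_64. 1 / real p) \<le> 0.319 + 14 / 64"
    "(\<Sum>p\<in>primes_11_128. 1 / real p) \<le> 0.4706 + 27 / 128"
    by (simp_all add: primes_11_128_def primes_11_64_def primes_11_32_def)
  thus "(\<Sum>p\<in>primes_11_32. 1 / real p - 1 / real 32) \<le> 0.1708"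
    "(\<Sum>p\<in>primes_11_64. 1 / real p - 1 / real 64) \<le> 0.319"
    "(\<Sum>p\<in>primes_11_128. 1 / real p - 1 / real 128) \<le> 0.4706"
    unfolding sum_subtractf sum_constant primes_11_facts by simp_all
qed

lemma primes_11_prods:
  "\<Prod>primes_11_32 = 955049953" "2 ^ 68 \<le> \<Prod>primes_11_64" "2 ^ 153 \<le> \<Prod>primes_11_128"
  by (simp_all add: primes_11_128_def primes_11_64_def primes_11_32_def)

text \<open>Transfers a lower bound from \<open>q ^ n\<close> to \<open>q ^ E\<close> when
  \<open>E / n\<close> is at least \<open>F / D\<close>. Comparing \<open>D\<close>-th powers avoids
  fractional exponents.\<close>

lemma power_ge_power2:
  fixes q n E :: nat
  assumes "2 ^ a \<le> q ^ n" "F * n \<le> D * E" "D * b \<le> F * a" "D > 0" "q > 0"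
  shows "2 ^ b \<le> q ^ E"
proof -
  have "(2 ^ b) ^ D = (2::nat) ^ (D * b)" by (simp add: mult.commute flip: power_mult)
  also have "\<dots> \<le> 2 ^ (F * a)" using assms(3) by (intro power_increasing) auto
  also have "\<dots> = (2 ^ a) ^ F" by (simp add: mult.commute flip: power_mult)
  also have "\<dots> \<le> (q ^ n) ^ F" using assms(1) by (intro power_mono) auto
  also have "\<dots> = q ^ (F * n)" by (simp add: mult.commute flip: power_mult)
  also have "\<dots> \<le> q ^ (D * E)" using assms(2,5) by (intro power_increasing) auto
  also have "\<dots> = (q ^ E) ^ D" by (simp add: mult.commute flip: power_mult)
  finally show ?thesis using assms(4) by (simp add: power_mono_iff)
qed

lemma le_sqrt_power:
  assumes "v ^ 2 \<le> real m" "m \<le> (q :: nat) ^ E"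
  shows "v \<le> sqrt (real (q ^ E))"
proof (rule real_le_rsqrt)
  have "real m \<le> real (q ^ E)" using assms(2) by (rule of_nat_mono)
  thus "v ^ 2 \<le> real (q ^ E)" using assms(1) by linarith
qed

section \<open>The small cases with \<open>q = 2\<close>\<close>

text \<open>Here \<open>q ^ E\<close> may be as low as \<open>2 ^ 13\<close>, reached for the pair
  (5,7). The gain comes from \<open>M\<close> being odd, which leaves at most three small
  primes.\<close>

lemma sieve_ok_two:
  assumes n: "30 \<le> n" "n < 57" and E: "13 \<le> E" "36 \<le> n \<Longrightarrow> 14 \<le> E" "42 \<le> n \<Longrightarrow> 15 \<le> E"
  shows "sieve_ok (2 ^ n - 1) (sqrt (real (2 ^ E)))"
proof -
  define M where "M = (2::nat) ^ n - 1"
  define s where "s = card (large_primes M)"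
  have "(2::nat) ^ 30 \<le> 2 ^ n" using n by (intro power_increasing) auto
  hence M: "M > 0" "M \<le> 2 ^ n" "odd M" using n by (auto simp: M_def)
  have small: "small_primes M \<subseteq> {3, 5, 7}"
    using small_primes_subset[of M] M(3) by (auto simp: small_primes_def)
  have card: "card (small_primes M) \<le> 3" using card_mono[OF _ small] by simp
  have finS: "finite (small_primes M)" using finite_subset[OF small] by simp
  have "32 ^ s * \<Prod>primes_11_32 * \<Prod>(small_primes M) \<le> M * 32 ^ card primes_11_32"
    unfolding s_def using large_primes_prod_bound[OF M(1) primes_11_facts(1), of 32] primes_11_range(1) large_primes_cases(1)
    by blast
  also have "\<dots> \<le> 2 ^ n * 2 ^ 35" unfolding primes_11_facts(4) using M(2) by simp
  finally have bd: "2 ^ (5 * s) * 955049953 * \<Prod>(small_primes M) \<le> (2::nat) ^ n * 2 ^ 35"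
    unfolding primes_11_prods(1) by (simp add: power_mult)
  \<comment> \<open>The contrapositive of \<open>bd\<close>: if \<open>n < m\<close>, then
    \<open>n + 35 \<le> m + 34\<close>, which contradicts the strict bound in the premise.\<close>
  have n_ge: "m \<le> n" if "2 ^ (m + 34) < 2 ^ (5 * t) * 955049953 * l" "t \<le> s" "l \<le> \<Prod>(small_primes M)" for m t l :: nat
  proof (rule ccontr)
    assume "\<not> m \<le> n"
    hence "(2::nat) ^ (n + 35) \<le> 2 ^ (m + 34)" by (intro power_increasing) auto
    also have "\<dots> < 2 ^ (5 * t) * 955049953 * l" by (rule that(1))
    also have "\<dots> \<le> 2 ^ (5 * s) * 955049953 * \<Prod>(small_primes M)"
      using that(2,3) by (intro mult_le_mono power_increasing) auto
    also have "\<dots> \<le> 2 ^ (n + 35)" using bd by (simp add: power_add)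
    finally show False by simp
  qed
  have sieve: "sieve_ok M (sqrt (real (2 ^ E)))"
    if "s \<le> s0" "1 \<le> s0" "card (small_primes M) \<le> w0" "s0 / 32 + 0.1708 \<le> \<delta>" "\<delta> < 1"
      "(2 ^ w0 * ((real s0 - 1) / (1 - \<delta>) + 2)) ^ 2 \<le> real (2 ^ e)" "e \<le> E" for s0 w0 e :: nat and \<delta>
  proof (rule sieve_ok_large_primes[OF M(1) that(1)[unfolded s_def] that(2,3) primes_11_facts(1)])
    show "real s0 / real 32 + (\<Sum>p\<in>primes_11_32. 1 / real p - 1 / real 32) \<le> \<delta>"
      using that(4) primes_11_sums(1) by simp
    show "2 ^ w0 * ((real s0 - 1) / (1 - \<delta>) + 2) \<le> sqrt (real (2 ^ E))"
      using that(6,7) by (intro le_sqrt_power[of _ "2 ^ e"] power_increasing) auto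
  qed (use primes_11_range(1) large_primes_cases(1) that(5) in auto)
  \<comment> \<open>A trade-off: if 3, 5, 7 all divide \<open>M\<close>, the factor 105 lowers the
    possible number of large primes; otherwise the character part costs 4 instead of 8.\<close>
  show ?thesis unfolding M_def[symmetric]
  proof (cases "small_primes M = {3, 5, 7}")
    case True
    hence prod: "105 \<le> \<Prod>(small_primes M)" by simp
    have "s \<ge> 7 \<Longrightarrow> 36 \<le> n" by (rule n_ge[of _ 7 105]) (use prod in auto)
    moreover have "s \<ge> 9 \<Longrightarrow> 42 \<le> n" by (rule n_ge[of _ 9 105]) (use prod in auto)
    moreover have "s \<ge> 11 \<Longrightarrow> 57 \<le> n" by (rule n_ge[of _ 11 105]) (use prod in auto)
    ultimately consider "s \<le> 6" | "s \<le> 8" "14 \<le> E" | "s \<le> 10" "15 \<le> E" using n E by linarith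
    thus "sieve_ok M (sqrt (real (2 ^ E)))"
    proof cases
      case 1
      show ?thesis by (rule sieve[of 6 3 "0.3583" 13]) (use 1 card E in \<open>simp_all add: power2_eq_square\<close>)
    next
      case 2
      show ?thesis by (rule sieve[of 8 3 "0.421" 14]) (use 2 card in \<open>simp_all add: power2_eq_square\<close>)
    next
      case 3
      show ?thesis by (rule sieve[of 10 3 "0.484" 15]) (use 3 card in \<open>simp_all add: power2_eq_square\<close>)
    qed
  next
    case False
    hence "card (small_primes M) < card {3, 5, 7::nat}"
      using small by (intro psubset_card_mono) auto
    hence card: "card (small_primes M) \<le> 2" by simp
    have "\<Prod>(small_primes M) > 0"
      using finS by (intro prod_pos) (auto simp: small_primes_def prime_gt_0_nat)
    hence prod: "1 \<le> \<Prod>(small_primes M)" by simp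
    have "s \<ge> 9 \<Longrightarrow> 36 \<le> n" by (rule n_ge[of _ 9 1]) (use prod in auto)
    moreover have "s \<ge> 13 \<Longrightarrow> 57 \<le> n" by (rule n_ge[of _ 13 1]) (use prod in auto)
    ultimately consider "s \<le> 8" | "s \<le> 12" "14 \<le> E" using n E by linarith
    thus "sieve_ok M (sqrt (real (2 ^ E)))"
    proof cases
      case 1
      show ?thesis by (rule sieve[of 8 2 "0.421" 13]) (use 1 card E in \<open>simp_all add: power2_eq_square\<close>)
    next
      case 2
      show ?thesis by (rule sieve[of 12 2 "0.546" 14]) (use 2 card in \<open>simp_all add: power2_eq_square\<close>)
    qed
  qed
qed

text \<open>
  A number below \<open>2 ^ (j * 2 ^ (j - 1))\<close> has fewer than \<open>2 ^ (j - 1)\<close> prime divisors above \<open>2 ^ j\<close>, so their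
  reciprocals add up to at most one half.
\<close>

lemma sieve_ok_power2:
  fixes M j k q E :: nat
  assumes M: "0 < M" "M < 2 ^ (j * 2 ^ (j - 1))" and j: "j \<ge> 1"
    and k: "card {p. prime p \<and> p < (2::nat) ^ j} \<le> k" and E: "2 ^ (2 * (k + j)) \<le> q ^ E"
  shows "sieve_ok M (sqrt (real (q ^ E)))"
proof -
  define S where "S = {p. prime p \<and> p dvd M \<and> p < 2 ^ j}"
  define T where "T = {p. prime p \<and> p dvd M \<and> 2 ^ j \<le> p}"
  have fin: "finite S" "finite T"
    using M(1) by (auto simp: S_def T_def intro: finite_subset[of _ "{..M}"] dvd_imp_le)
  have "card S \<le> card {p. prime p \<and> p < (2::nat) ^ j}"
    unfolding S_def by (intro card_mono) auto
  hence S: "card S \<le> k" using k by simp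
  have "(2::nat) ^ (j * card T) = (\<Prod>p\<in>T. 2 ^ j)" by (simp add: power_mult)
  also have "\<dots> \<le> \<Prod>T" by (rule prod_mono) (auto simp: T_def)
  also have "\<dots> \<le> M" using fin M(1) by (intro dvd_imp_le prod_primes_dvd) (auto simp: T_def)
  finally have "(2::nat) ^ (j * card T) \<le> M" .
  hence "(2::nat) ^ (j * card T) < 2 ^ (j * 2 ^ (j - 1))" using M(2) by (rule le_less_trans)
  hence T: "card T < 2 ^ (j - 1)" using j by simp
  have half: "real (2 ^ (j - 1)) / real (2 ^ j) = 1 / 2" using j by (cases j) auto
  have "(\<Sum>p\<in>T. 1 / real p) \<le> (\<Sum>p\<in>T. 1 / real (2 ^ j))"
  proof (rule sum_mono)
    fix p assume "p \<in> T"
    hence "real (2 ^ j) \<le> real p" unfolding T_def of_nat_le_iff by simp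
    thus "1 / real p \<le> 1 / real (2 ^ j)" by (intro frac_le) auto
  qed
  also have "\<dots> = real (card T) / real (2 ^ j)" by simp
  also have "\<dots> \<le> real (2 ^ (j - 1)) / real (2 ^ j)"
    using T by (intro divide_right_mono of_nat_mono) auto
  finally have sum: "(\<Sum>p\<in>T. 1 / real p) \<le> 1 / 2" unfolding half .
  have "2 ^ card S * ((real (card T) - 1) / (1 - (\<Sum>p\<in>T. 1 / real p)) + 2)
      \<le> 2 ^ k * ((real (2 ^ (j - 1)) - 1) / (1 - 1 / 2) + 2)"
    \<comment> \<open>With \<open>2 ^ (j - 1)\<close> primes and reciprocal sum one half, the
      bracket is exactly \<open>2 ^ j\<close>.\<close>
    using T S sum by (intro sieve_bound_mono) auto
  also have "\<dots> = 2 ^ k * (2 * 2 ^ (j - 1))" by (simp add: algebra_simps)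
  also have "\<dots> = 2 ^ (k + j)" using j by (cases j) (auto simp: power_add)
  also have "\<dots> \<le> sqrt (real (q ^ E))"
    using E by (intro le_sqrt_power[of _ "2 ^ (2 * (k + j))"]) (simp_all add: mult.commute flip: power_mult)
  finally show ?thesis unfolding sieve_ok_def using fin sum
    by (intro exI[of _ S] exI[of _ T]) (auto simp: S_def T_def)
qed

section \<open>Prime counts and the sieve condition for large \<open>q ^ n\<close>\<close>

text \<open>Apart from 2, 3, 5, primes occupy eight residue classes modulo 30, and
  \<open>x div 30 + 1\<close> blocks have to be covered. A linear bound suffices, since the
  available exponent \<open>(j - 1) * 2 ^ (j - 2)\<close> has the extra factor
  \<open>j - 1\<close>.\<close>

lemma card_primes_less:
  fixes x :: nat
  shows "card {p. prime p \<and> p < x} \<le> 11 + 8 * (x div 30)"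
proof -
  define R where "R = {1, 7, 11, 13, 17, 19, 23, 29 :: nat}"
  have "{p. prime p \<and> p < x} \<subseteq> {2, 3, 5} \<union> (\<lambda>(a, r). 30 * a + r) ` ({..x div 30} \<times> R)"
  proof
    fix p assume "p \<in> {p. prime p \<and> p < x}"
    hence p: "prime p" "p < x" by auto
    show "p \<in> {2, 3, 5} \<union> (\<lambda>(a, r). 30 * a + r) ` ({..x div 30} \<times> R)"
    proof (cases "p \<in> {2, 3, 5}")
      case False
      have "\<not> r dvd p" if "r \<in> {2, 3, 5}" for r
      proof
        assume "r dvd p"
        moreover have "r \<noteq> 1" "r \<noteq> p" using that False by auto
        ultimately show False using p(1) by (meson prime_nat_iff)
      qed
      hence "\<not> r dvd p mod 30" if "r \<in> {2, 3, 5}" for r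
        using that dvd_mod_iff[of r 30 p] by auto
      hence "p mod 30 \<in> set (filter (\<lambda>m. \<not> 2 dvd m \<and> \<not> 3 dvd m \<and> \<not> 5 dvd m) [0..<30])" by simp
      also have "filter (\<lambda>m. \<not> 2 dvd m \<and> \<not> 3 dvd m \<and> \<not> 5 dvd m) [0..<30] = [1, 7, 11, 13, 17, 19, 23, 29::nat]"
        by (simp add: upt_rec[of 0] upt_rec[of "Suc 0"] upt_rec_numeral flip: numeral_2_eq_2)
      also have "set \<dots> = R" by (simp add: R_def)
      finally have "(p div 30, p mod 30) \<in> {..x div 30} \<times> R" using p(2) by (simp add: div_le_mono)
      moreover have "p = (\<lambda>(a, r). 30 * a + r) (p div 30, p mod 30)" by simp
      ultimately show ?thesis by blast
    qed auto
  qed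
  hence "card {p. prime p \<and> p < x} \<le> card ({2, 3, 5} \<union> (\<lambda>(a, r). 30 * a + r) ` ({..x div 30} \<times> R))"
    by (intro card_mono) (auto simp: R_def)
  also have "\<dots> \<le> card {2, 3, 5 :: nat} + card ((\<lambda>(a, r). 30 * a + r) ` ({..x div 30} \<times> R))"
    by (rule card_Un_le)
  also have "card ((\<lambda>(a, r). 30 * a + r) ` ({..x div 30} \<times> R)) \<le> card ({..x div 30} \<times> R)"
    by (rule card_image_le) (auto simp: R_def)
  also have "\<dots> = 8 + 8 * (x div 30)" by (simp add: card_cartesian_product R_def)
  finally show ?thesis by simp
qed

lemma card_primes_less_256: "card {p::nat. prime p \<and> p < 256} \<le> 55"
proof -
  define F where "F = filter (\<lambda>p::nat. \<forall>r\<in>{2, 3, 5, 7, 11, 13}. r < 17 \<longrightarrow> \<not> r dvd p) [17..<256]"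
  \<comment> \<open>Composites below 289 have a prime factor at most 13, so \<open>F\<close> lists
    exactly the primes from 17 on. The composite entry 15 is harmless; it makes the count 55 rather
    than 54.\<close>
  have "p \<in> set ([2, 3, 5, 7, 11, 13, 15] @ F)" if p: "prime p" "p < 256" for p :: nat
  proof -
    consider "p < 11" | "11 \<le> p" "p < 17" | "17 \<le> p" by linarith
    thus ?thesis
    proof cases
      case 1
      thus ?thesis using prime_less_11[OF p(1)] by auto
    next
      case 2
      have "p \<in> set (filter (\<lambda>p. \<forall>r\<in>{2, 3, 5, 7, 11, 13}. r < 11 \<longrightarrow> \<not> r dvd p) [11..<17])"
        by (rule prime_cases_sieve[OF p(1) 2]) simp
      thus ?thesis by (auto simp: upt_rec_numeral)
    next
      case 3
      hence "p \<in> set F" unfolding F_def by (intro prime_cases_sieve p) auto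
      thus ?thesis by simp
    qed
  qed
  hence "card {p::nat. prime p \<and> p < 256} \<le> card (set ([2, 3, 5, 7, 11, 13, 15] @ F))"
    by (intro card_mono) auto
  also have "\<dots> \<le> length ([2, 3, 5, 7, 11, 13, 15] @ F)" by (rule card_length)
  also have "\<dots> = 55" by (simp add: F_def upt_rec_numeral)
  finally show ?thesis .
qed

lemma card_primes_less_512: "card {p::nat. prime p \<and> p < 512} \<le> 128"
proof -
  define F where "F = filter (\<lambda>p::nat. \<forall>r\<in>{2, 3, 5, 7, 11, 13}. r < 11 \<longrightarrow> \<not> r dvd p) [11..<512]"
  have "p \<in> set ([2, 3, 5, 7] @ F)" if p: "prime p" "p < 512" for p :: nat
  proof (cases "p < 11")
    case True
    thus ?thesis using prime_less_11[OF p(1)] by auto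
  next
    case False
    hence "p \<in> set F" unfolding F_def by (intro prime_cases_sieve p) auto
    thus ?thesis by simp
  qed
  hence "card {p::nat. prime p \<and> p < 512} \<le> card (set ([2, 3, 5, 7] @ F))"
    by (intro card_mono) auto
  also have "\<dots> \<le> length ([2, 3, 5, 7] @ F)" by (rule card_length)
  also have "\<dots> \<le> 128" by (simp add: F_def upt_rec_numeral)
  finally show ?thesis .
qed

text \<open>With \<open>m\<close> the least admissible level in \<open>sieve_ok_power2\<close>,
  failure at level \<open>m - 1\<close> bounds \<open>q ^ n\<close> from below. The hypothesis on
  \<open>j\<close> says that this already pays for the cost at level \<open>m\<close>.\<close>

lemma sieve_ok_huge:
  fixes q n E D F j0 :: nat
  assumes q: "q \<ge> 2" and n: "n > 0" and j0: "j0 \<ge> 2" and DF: "D > 0" "F * n \<le> D * E"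
    and N: "2 ^ ((j0 - 1) * 2 ^ (j0 - 2)) \<le> q ^ n"
    and j: "\<And>j. j0 \<le> j \<Longrightarrow> D * (2 * (11 + 8 * (2 ^ j div 30) + j)) \<le> F * ((j - 1) * 2 ^ (j - 2))"
  shows "sieve_ok (q ^ n - 1) (sqrt (real (q ^ E)))"
proof -
  define P where "P j \<longleftrightarrow> q ^ n < 2 ^ (j * 2 ^ (j - 1))" for j :: nat
  have "q ^ n \<ge> 2 ^ 1" using q n self_le_power[of q n] by simp
  hence M: "0 < q ^ n - 1" by simp
  have "q ^ n < 2 ^ (q ^ n)" by simp
  also have "(2::nat) ^ (q ^ n) \<le> 2 ^ (q ^ n * 2 ^ (q ^ n - 1))" by (rule power_increasing) auto
  finally have "P (q ^ n)" unfolding P_def .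
  define m where "m = (LEAST j. P j)"
  have Pm: "P m" unfolding m_def by (rule LeastI[of P, OF \<open>P (q ^ n)\<close>])
  have least: "\<not> P i" if "i < m" for i using that not_less_Least unfolding m_def by blast
  have mono: "P i \<Longrightarrow> i \<le> i' \<Longrightarrow> P i'" for i i'
  proof -
    assume "P i" "i \<le> i'"
    hence "i * 2 ^ (i - 1) \<le> i' * 2 ^ (i' - 1)" by (intro mult_le_mono power_increasing) auto
    hence "(2::nat) ^ (i * 2 ^ (i - 1)) \<le> 2 ^ (i' * 2 ^ (i' - 1))" by (rule power_increasing) auto
    thus "P i'" using \<open>P i\<close> unfolding P_def by linarith
  qed
  have "\<not> P (j0 - 1)" using N j0 unfolding P_def by (simp add: numeral_2_eq_2 diff_diff_eq)
  hence mj: "j0 \<le> m" using mono[OF Pm, of "j0 - 1"] by linarith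
  have "\<not> P (m - 1)" using least[of "m - 1"] mj j0 by simp
  hence low: "2 ^ ((m - 1) * 2 ^ (m - 2)) \<le> q ^ n" unfolding P_def using mj j0
    by (simp add: not_less numeral_2_eq_2 diff_diff_eq)
  show ?thesis
  proof (rule sieve_ok_power2[OF M _ _ card_primes_less])
    show "q ^ n - 1 < 2 ^ (m * 2 ^ (m - 1))" using Pm unfolding P_def by linarith
    show "2 ^ (2 * (11 + 8 * (2 ^ m div 30) + m)) \<le> q ^ E"
      by (rule power_ge_power2[OF low DF(2) j[OF mj] DF(1)]) (use q in simp)
  qed (use mj j0 in simp)
qed

text \<open>The ratios belong to the pairs (3,38), (4,5) and (3,5). In \<open>lin\<close>, the main
  term of the prime count takes \<open>32 * D\<close> out of \<open>15 * F * (j - 1)\<close>, and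
  \<open>c\<close> is a share of the rest that pays for the lower-order term
  \<open>11 + j\<close>.\<close>

lemma huge_condition:
  fixes j :: nat
  shows "10 \<le> j \<Longrightarrow> 114 * (2 * (11 + 8 * (2 ^ j div 30) + j)) \<le> 34 * ((j - 1) * 2 ^ (j - 2))"
    and "12 \<le> j \<Longrightarrow> 5 * (2 * (11 + 8 * (2 ^ j div 30) + j)) \<le> 1 * ((j - 1) * 2 ^ (j - 2))"
    and "34 \<le> j \<Longrightarrow> 15 * (2 * (11 + 8 * (2 ^ j div 30) + j)) \<le> 1 * ((j - 1) * 2 ^ (j - 2))"
proof -
  have lin: "D * (2 * (11 + 8 * (2 ^ j div 30) + j)) \<le> F * ((j - 1) * 2 ^ (j - 2))"
    if "15 * F * (j - 1) \<ge> 32 * D + c" "30 * D * (11 + j) \<le> c * 2 ^ (j - 2)" "j \<ge> 2" for D F c :: nat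
  proof -
    have "(2::nat) ^ (2 + (j - 2)) = 4 * 2 ^ (j - 2)" by (simp add: power_add)
    moreover have "2 + (j - 2) = j" using that(3) by simp
    ultimately have "(2::nat) ^ j = 4 * 2 ^ (j - 2)" by metis
    moreover have "30 * ((2::nat) ^ j div 30) \<le> 2 ^ j" by simp
    ultimately have "30 * ((2::nat) ^ j div 30) \<le> 4 * 2 ^ (j - 2)" by linarith
    hence "8 * D * (30 * (2 ^ j div 30)) \<le> 8 * D * (4 * 2 ^ (j - 2))" by (rule mult_le_mono2)
    hence "15 * (D * (2 * (11 + 8 * (2 ^ j div 30) + j))) \<le> 30 * D * (11 + j) + 32 * D * 2 ^ (j - 2)"
      by (simp add: algebra_simps)
    also have "\<dots> \<le> (32 * D + c) * 2 ^ (j - 2)" using that(2) by (simp add: algebra_simps)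
    also have "\<dots> \<le> 15 * F * (j - 1) * 2 ^ (j - 2)" using that(1) by (rule mult_le_mono1)
    finally show ?thesis by simp
  qed
  have pow: "c * 2 ^ (i - 2) \<ge> b * (11 + i)" if "i0 \<le> i" "2 \<le> i0" "c * 2 ^ (i0 - 2) \<ge> b * (11 + i0)" for b c i i0 :: nat
    using that(1)
  proof (induction i rule: dec_induct)
    case (step i)
    have "Suc i - 2 = Suc (i - 2)" using step.hyps that(2) by linarith
    hence "c * 2 ^ (Suc i - 2) = 2 * (c * 2 ^ (i - 2))" by simp
    moreover have "b * (11 + Suc i) \<le> 2 * (b * (11 + i))" by (simp add: algebra_simps)
    ultimately show ?case using step.IH by linarith
  qed (use that in simp)
  show "10 \<le> j \<Longrightarrow> 114 * (2 * (11 + 8 * (2 ^ j div 30) + j)) \<le> 34 * ((j - 1) * 2 ^ (j - 2))"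
    by (rule lin[where c = 900]) (use pow[of 10 j 3420 900] in auto)
  show "12 \<le> j \<Longrightarrow> 5 * (2 * (11 + 8 * (2 ^ j div 30) + j)) \<le> 1 * ((j - 1) * 2 ^ (j - 2))"
    by (rule lin[where c = 5]) (use pow[of 12 j 150 5] in auto)
  show "34 \<le> j \<Longrightarrow> 15 * (2 * (11 + 8 * (2 ^ j div 30) + j)) \<le> 1 * ((j - 1) * 2 ^ (j - 2))"
    by (rule lin[where c = 15]) (use pow[of 34 j 450 15] in auto)
qed

lemma sieve_ok_medium:
  fixes q n E :: nat
  assumes q: "q \<ge> 2" and n: "n > 0" and E: "724 ^ 2 \<le> q ^ E"
    and disj: "n \<le> 3 * E \<or> 2 ^ 34 \<le> q ^ E \<and> 34 * n \<le> 114 * E"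
  shows "sieve_ok (q ^ n - 1) (sqrt (real (q ^ E)))"
proof -
  define M where "M = q ^ n - 1"
  define s where "s = card (large_primes M)"
  have "q ^ n \<ge> 2 ^ 1" using q n self_le_power[of q n] by simp
  hence M: "M > 0" "M \<le> q ^ n" by (auto simp: M_def)
  have ratio: "34 * n \<le> 114 * E" using disj by linarith
  have "\<Prod>(small_primes M) > 0"
    using finite_subset[OF small_primes_subset] by (intro prod_pos) (auto simp: small_primes_def prime_gt_0_nat)
  hence S: "1 \<le> \<Prod>(small_primes M)" by simp
  have bd64: "2 ^ (6 * s) * 2 ^ 68 \<le> q ^ n * 2 ^ 84"
  proof -
    have "64 ^ s * 2 ^ 68 * 1 \<le> 64 ^ s * \<Prod>primes_11_64 * \<Prod>(small_primes M)"
      using primes_11_prods(2) S by (intro mult_le_mono) auto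
    also have "\<dots> \<le> M * 64 ^ card primes_11_64"
      unfolding s_def using large_primes_prod_bound[OF M(1) primes_11_facts(2), of 64] primes_11_range(2) large_primes_cases(2)
      by blast
    also have "\<dots> \<le> q ^ n * 64 ^ card primes_11_64" using M(2) by (intro mult_le_mono1)
    finally show ?thesis unfolding primes_11_facts(5) by (simp add: power_mult)
  qed
  have bd128: "2 ^ (7 * s) * 2 ^ 153 \<le> q ^ n * 2 ^ 189"
  proof -
    have "128 ^ s * 2 ^ 153 * 1 \<le> 128 ^ s * \<Prod>primes_11_128 * \<Prod>(small_primes M)"
      using primes_11_prods(3) S by (intro mult_le_mono) auto
    also have "\<dots> \<le> M * 128 ^ card primes_11_128"
      unfolding s_def using large_primes_prod_bound[OF M(1) primes_11_facts(3), of 128] primes_11_range(3) large_primes_cases(3)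
      by blast
    also have "\<dots> \<le> q ^ n * 128 ^ card primes_11_128" using M(2) by (intro mult_le_mono1)
    finally show ?thesis unfolding primes_11_facts(6) by (simp add: power_mult)
  qed
  have N: "2 ^ a \<le> q ^ n" if "2 ^ m * 2 ^ b \<le> q ^ n * 2 ^ c" "a + c \<le> m + b" for a b c m
  proof -
    have "2 ^ a * 2 ^ c \<le> (2::nat) ^ m * 2 ^ b"
      unfolding power_add[symmetric] using that(2) by (intro power_increasing) auto
    hence "2 ^ a * 2 ^ c \<le> q ^ n * 2 ^ c" using that(1) by linarith
    thus ?thesis by simp
  qed
  \<comment> \<open>With cutoff 64 the reciprocal bound \<open>s / 64 + 0.319\<close> reaches 1
    between 43 and 44, with cutoff 128 just past 67. Near these limits the sieve bound explodes, so
    the cutoff changes at 35, and from 67 on small primes up to a power of two move to the character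
    part.\<close>
  consider "s \<le> 14" | "15 \<le> s" "s \<le> 34" | "35 \<le> s" "s \<le> 66" | "67 \<le> s" by linarith
  hence "sieve_ok M (sqrt (real (q ^ E)))"
  proof cases
    case 1
    show ?thesis
    proof (rule sieve_ok_large_primes[OF M(1) 1[unfolded s_def] _ card_small_primes primes_11_facts(2) primes_11_range(2) _ large_primes_cases(2)])
      show "real 14 / real 64 + (\<Sum>p\<in>primes_11_64. 1 / real p - 1 / real 64) \<le> 0.54" using primes_11_sums(2) by simp
      show "2 ^ 4 * ((real 14 - 1) / (1 - 0.54) + 2) \<le> sqrt (real (q ^ E))"
        by (rule le_sqrt_power[OF _ E]) (simp add: power2_eq_square)
    qed simp_all
  next
    case 2
    \<comment> \<open>From \<open>2 ^ 74 \<le> q ^ n\<close> the ratio 1/3 yields exponent 24 but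
      34/114 only 22; in the latter case the separate bound \<open>2 ^ 34\<close> steps in.\<close>
    have "2 ^ 24 \<le> q ^ E"
    proof (cases "n \<le> 3 * E")
      case True
      have "2 ^ 74 \<le> q ^ n" using 2 by (intro N[OF bd64]) auto
      thus ?thesis by (rule power_ge_power2[of _ _ _ 1 3]) (use True q in auto)
    next
      case False
      hence "2 ^ 34 \<le> q ^ E" using disj by blast
      moreover have "(2::nat) ^ 24 \<le> 2 ^ 34" by simp
      ultimately show ?thesis by (rule le_trans[rotated])
    qed
    show ?thesis
    proof (rule sieve_ok_large_primes[OF M(1) 2(2)[unfolded s_def] _ card_small_primes primes_11_facts(2) primes_11_range(2) _ large_primes_cases(2)])
      show "real 34 / real 64 + (\<Sum>p\<in>primes_11_64. 1 / real p - 1 / real 64) \<le> 0.851" using primes_11_sums(2) by simp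
      show "2 ^ 4 * ((real 34 - 1) / (1 - 0.851) + 2) \<le> sqrt (real (q ^ E))"
        by (rule le_sqrt_power[OF _ \<open>2 ^ 24 \<le> q ^ E\<close>]) (simp add: power2_eq_square)
    qed simp_all
  next
    case 3
    have "2 ^ 194 \<le> q ^ n" using 3 by (intro N[OF bd64]) auto
    hence big: "2 ^ 33 \<le> q ^ E"
      by (rule power_ge_power2[OF _ ratio]) (use q in auto)
    show ?thesis
    proof (rule sieve_ok_large_primes[OF M(1) 3(2)[unfolded s_def] _ card_small_primes primes_11_facts(3) primes_11_range(3) _ large_primes_cases(3)])
      show "real 66 / real 128 + (\<Sum>p\<in>primes_11_128. 1 / real p - 1 / real 128) \<le> 0.987" using primes_11_sums(3) by simp
      show "2 ^ 4 * ((real 66 - 1) / (1 - 0.987) + 2) \<le> sqrt (real (q ^ E))"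
        by (rule le_sqrt_power[OF _ big]) (simp add: power2_eq_square)
    qed simp_all
  next
    case 4
    have N430: "2 ^ 430 \<le> q ^ n" using 4 by (intro N[OF bd128]) auto
    \<comment> \<open>The cuts are \<open>j * 2 ^ (j - 1)\<close> for \<open>j = 8\<close> and
      \<open>j = 9\<close>. At these levels the count modulo 30 would give 75 and 147 primes, too
      many for the lower bounds at hand, hence the explicit counts 55 and 128.\<close>
    consider "q ^ n < 2 ^ 1024" | "2 ^ 1024 \<le> q ^ n" "q ^ n < 2 ^ 2304" | "2 ^ 2304 \<le> q ^ n" by linarith
    thus ?thesis
    proof cases
      case 1
      show ?thesis
      proof (rule sieve_ok_power2[OF M(1), of 8 55])
        show "2 ^ (2 * (55 + 8)) \<le> q ^ E"
          by (rule power_ge_power2[OF N430 ratio]) (use q in auto)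
        have "8 * 2 ^ (8 - 1) = (1024::nat)" by simp
        thus "M < 2 ^ (8 * 2 ^ (8 - 1))" using 1 M unfolding M_def by presburger
      qed (use card_primes_less_256 in auto)
    next
      case 2
      show ?thesis
      proof (rule sieve_ok_power2[OF M(1), of 9 128])
        show "2 ^ (2 * (128 + 9)) \<le> q ^ E"
          by (rule power_ge_power2[OF 2(1) ratio]) (use q in auto)
        have "9 * 2 ^ (9 - 1) = (2304::nat)" by simp
        thus "M < 2 ^ (9 * 2 ^ (9 - 1))" using 2(2) M unfolding M_def by presburger
      qed (use card_primes_less_512 in auto)
    next
      case 3
      show ?thesis unfolding M_def
        by (rule sieve_ok_huge[OF q n _ _ ratio, of 10]) (use 3 huge_condition(1) in auto)
    qed
  qed
  thus ?thesis unfolding M_def .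
qed

subsection \<open>The theorem\<close>

text \<open>The value \<open>724 ^ 2\<close> lies just below \<open>3 ^ 12\<close>, which is
  \<open>q ^ E\<close> for the pair (4,9) at its smallest \<open>n\<close> and \<open>q = 3\<close>.
  The alternative with \<open>E = 10\<close> and \<open>q = 5\<close> serves the pair (5,6).\<close>

lemma sieve_ok_mediumI:
  fixes q n E :: nat
  assumes n: "n > 0" and E: "20 \<le> E \<and> 2 \<le> q \<or> 12 \<le> E \<and> 3 \<le> q \<or> 10 \<le> E \<and> 5 \<le> q"
    and disj: "n \<le> 3 * E \<or> 34 \<le> E \<and> 34 * n \<le> 114 * E"
  shows "sieve_ok (q ^ n - 1) (sqrt (real (q ^ E)))"
proof (rule sieve_ok_medium[OF _ n])
  show q: "q \<ge> 2" using E by auto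
  have pow: "b ^ e \<le> q ^ E" if "b \<le> q" "e \<le> E" for b e
  proof -
    have "b ^ e \<le> q ^ e" using that(1) by (intro power_mono) auto
    also have "\<dots> \<le> q ^ E" using that(2) q by (intro power_increasing) auto
    finally show ?thesis .
  qed
  have "(2::nat) ^ 20 \<le> q ^ E \<or> 3 ^ 12 \<le> q ^ E \<or> 5 ^ 10 \<le> q ^ E" using E pow by blast
  thus "724 ^ 2 \<le> q ^ E" by auto
  have "2 ^ 34 \<le> q ^ E" if "34 \<le> E" using pow[OF q that] .
  thus "n \<le> 3 * E \<or> 2 ^ 34 \<le> q ^ E \<and> 34 * n \<le> 114 * E" using disj by blast
qed

text \<open>Only \<open>exp 1 \<ge> 2\<close> enters: it turns the hypothesis into
  \<open>2 ^ m \<le> q\<close>, hence \<open>2 ^ (m * n) \<le> q ^ n\<close>.\<close>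

lemma sieve_ok_exp:
  fixes q n E m j0 :: nat
  assumes q: "exp X \<le> real q" "real m \<le> X" and n: "n > 0" and j0: "j0 \<ge> 2" "(j0 - 1) * 2 ^ (j0 - 2) \<le> m * n"
    and DF: "D > 0" "F * n \<le> D * E" "m > 0"
    and j: "\<And>j. j0 \<le> j \<Longrightarrow> D * (2 * (11 + 8 * (2 ^ j div 30) + j)) \<le> F * ((j - 1) * 2 ^ (j - 2))"
  shows "sieve_ok (q ^ n - 1) (sqrt (real (q ^ E)))"
proof -
  have "real (2 ^ m) = 2 ^ m" by simp
  also have "\<dots> \<le> exp 1 ^ m" using exp_ge_add_one_self[of 1] by (intro power_mono) auto
  also have "\<dots> = exp (real m)" by (simp flip: exp_of_nat_mult)
  also have "\<dots> \<le> exp X" using q(2) by simp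
  also note q(1)
  finally have qm: "2 ^ m \<le> q" unfolding of_nat_le_iff .
  have "(2::nat) ^ 1 \<le> 2 ^ m" using DF(3) by (intro power_increasing) auto
  hence q2: "q \<ge> 2" using qm unfolding power_one_right by (rule le_trans)
  have "(2::nat) ^ ((j0 - 1) * 2 ^ (j0 - 2)) \<le> 2 ^ (m * n)" using j0(2) by (rule power_increasing) auto
  also have "\<dots> = (2 ^ m) ^ n" by (rule power_mult)
  also have "\<dots> \<le> q ^ n" using qm by (rule power_mono) auto
  finally show ?thesis using sieve_ok_huge[OF q2 n j0(1) DF(1,2) _ j] by blast
qed

text \<open>564 is the least \<open>m\<close> with \<open>11 * 2 ^ 10 \<le> m * 20\<close>, the size
  required in \<open>sieve_ok_exp\<close> for \<open>j0 = 12\<close> and the smallest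
  \<open>n = 20\<close>.\<close>

lemma exp_6_7_ge: "(564::real) \<le> exp 6.7"
proof -
  have "(1 + 6.7 / real 100) ^ 100 \<le> exp (6.7::real)"
    by (rule exp_ge_one_plus_x_over_n_power_n) auto
  moreover have "(564::real) \<le> (1 + 6.7 / real 100) ^ 100" by (simp add: power_divide)
  ultimately show ?thesis by linarith
qed

text \<open>Needed for \<open>j0 = 34\<close> and \<open>n \<ge> 15\<close>, where
  \<open>33 * 2 ^ 32 \<le> 2 ^ 34 * 15\<close> leaves room to spare.\<close>

lemma exp_26_1_ge: "(2::real) ^ 34 \<le> exp 26.1"
proof -
  have "(1 + 1 / real 10) ^ 10 \<le> exp (1::real)"
    by (rule exp_ge_one_plus_x_over_n_power_n) auto
  moreover have "(5 / 2 :: real) \<le> (1 + 1 / real 10) ^ 10" by (simp add: power_divide)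
  ultimately have "(5 / 2) ^ 26 \<le> exp (1::real) ^ 26" by (intro power_mono) auto
  also have "\<dots> = exp 26" by (simp flip: exp_of_nat_mult)
  also have "\<dots> \<le> exp (26.1 :: real)" by simp
  finally have "(5 / 2) ^ 26 \<le> exp (26.1 :: real)" .
  moreover have "(2::real) ^ 34 \<le> (5 / 2) ^ 26" by (simp add: power_divide)
  ultimately show ?thesis by (rule order_trans[rotated])
qed

section \<open>Bounding \<open>\<lambda>\<close> by the product of the divisors\<close>

text \<open>Equality holds at (2,3,5), where \<open>\<lambda> = 8\<close> and the product is
  30.\<close>

lemma lambda_bound_three:
  fixes x y z :: nat
  assumes "2 \<le> x" "3 \<le> y" "5 \<le> z"
  shows "15 * (1 + ((x - 1) + (y - 1) + (z - 1))) \<le> 4 * (x * y * z)"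
proof -
  obtain a b c where "x = 2 + a" "y = 3 + b" "z = 5 + c" using assms by (metis le_Suc_ex)
  thus ?thesis by (simp add: algebra_simps)
qed

text \<open>A further divisor multiplies the product by \<open>d i\<close> and
  \<open>\<lambda>\<close> by at most \<open>d i\<close>, so the worst ratio is that of the initial
  triple.\<close>

lemma lambda_bound_extend:
  fixes d :: "'i \<Rightarrow> nat"
  assumes "finite I" "J \<subseteq> I" "\<And>i. i \<in> I \<Longrightarrow> d i \<ge> 1"
    and "15 * (1 + (\<Sum>i\<in>J. d i - 1)) \<le> 4 * (\<Prod>i\<in>J. d i)"
  shows "15 * (1 + (\<Sum>i\<in>I. d i - 1)) \<le> 4 * (\<Prod>i\<in>I. d i)"
proof -
  have "15 * (1 + (\<Sum>i\<in>J \<union> K. d i - 1)) \<le> 4 * (\<Prod>i\<in>J \<union> K. d i)"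
    if "finite K" "K \<subseteq> I" "K \<inter> J = {}" for K
    using that
  proof (induction K rule: finite_induct)
    case (insert i K)
    let ?s = "\<Sum>i\<in>J \<union> K. d i - 1" and ?P = "\<Prod>i\<in>J \<union> K. d i"
    have fin: "finite (J \<union> K)" using assms(1,2) insert.hyps finite_subset by auto
    have i: "i \<notin> J \<union> K" using insert by auto
    obtain e where e: "d i = Suc e" using assms(3)[of i] insert.prems by (cases "d i") auto
    have "15 * (1 + ?s) \<le> 4 * ?P" using insert by auto
    hence "15 * (1 + ?s) * d i \<le> 4 * ?P * d i" by (rule mult_le_mono1)
    moreover have "15 * (1 + (e + ?s)) \<le> 15 * (1 + ?s) * d i" by (simp add: e algebra_simps)
    moreover have "4 * ?P * d i = 4 * (d i * ?P)" by simp
    ultimately have "15 * (1 + (e + ?s)) \<le> 4 * (d i * ?P)" by linarith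
    moreover have "(\<Sum>i\<in>J \<union> insert i K. d i - 1) = e + ?s" "(\<Prod>i\<in>J \<union> insert i K. d i) = d i * ?P"
      using fin i e by simp_all
    ultimately show ?case by simp
  qed (use assms(4) in auto)
  from this[of "I - J"] show ?thesis using assms(1,2) by (simp add: Un_absorb1 Diff_disjoint[THEN trans[OF Int_commute]])
qed

text \<open>The hypotheses give \<open>n \<ge> 30\<close> and \<open>15 * E \<ge> 7 * n\<close>, so
  \<open>E \<ge> 14\<close> throughout and \<open>E \<ge> 20\<close> once
  \<open>n \<ge> 57\<close>.\<close>

lemma sieve_ok_three_or_more:
  fixes q n E l :: nat
  assumes "q \<ge> 2" "n = E + 2 * l" "15 * l \<le> 4 * n" "8 \<le> l"
  shows "sieve_ok (q ^ n - 1) (sqrt (real (q ^ E)))"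
proof (cases "q = 2 \<and> n < 57")
  case True
  have "sieve_ok (2 ^ n - 1) (sqrt (real (2 ^ E)))"
    by (rule sieve_ok_two) (use assms True in linarith)+
  thus ?thesis using True by simp
next
  case False
  show ?thesis by (rule sieve_ok_mediumI) (use assms False in linarith)+
qed

lemma sieve_ok_two_divisors:
  fixes q n E x y :: nat
  assumes q: "q \<ge> 2" and n: "n = E + 2 * (x + y - 1)" "x * y \<le> n" and xy: "x < y"
    and cases: "(x \<ge> 5 \<and> ((x, y) = (5, 6) \<longrightarrow> q \<ge> 5)) \<or>
      (x = 4 \<and> (y \<ge> 11 \<or> (y \<ge> 9 \<and> q \<ge> 3) \<or> (y \<in> {5, 7} \<and> real q \<ge> exp (exp 6.7)))) \<or>
      (x = 3 \<and> (y \<ge> 38 \<or> (y \<ge> 5 \<and> real q \<ge> exp (exp 26.1))))"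
  shows "sieve_ok (q ^ n - 1) (sqrt (real (q ^ E)))"
proof -
  have two: "sieve_ok (q ^ n - 1) (sqrt (real (q ^ E)))"
    if "30 \<le> n" "n < 57" "13 \<le> E" "36 \<le> n \<Longrightarrow> 14 \<le> E" "42 \<le> n \<Longrightarrow> 15 \<le> E" "q = 2"
    using sieve_ok_two[OF that(1-5)] that(6) by simp
  have xy_le: "a * b \<le> n" if "a \<le> x" "b \<le> y" for a b
    using mult_le_mono[OF that] n(2) by linarith
  consider "x \<ge> 5" "(x, y) \<noteq> (5, 6)" | "x = 5" "y = 6" "q \<ge> 5"
    | "x = 4" "y \<ge> 11" | "x = 4" "y \<ge> 9" "q \<ge> 3" | "x = 4" "y \<in> {5, 7}" "real q \<ge> exp (exp 6.7)"
    | "x = 3" "y \<ge> 38" | "x = 3" "y \<ge> 5" "real q \<ge> exp (exp 26.1)"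
    using cases by blast
  thus ?thesis
  proof cases
    case 1
    have y7: "7 \<le> y" using 1 xy by auto
    have n35: "35 \<le> n" using xy_le[of 5 7] 1 y7 by simp
    \<comment> \<open>Sharp at the pair (5,7), the smallest one here.\<close>
    have "35 * (x + y - 1) \<le> 11 * (x * y)"
    proof -
      obtain a b where "x = 5 + a" "y = 7 + b" using 1(1) y7 by (metis le_Suc_ex)
      thus ?thesis by (simp add: algebra_simps)
    qed
    hence E: "13 * n \<le> 35 * E" using n by linarith
    show ?thesis
    proof (cases "q = 2 \<and> n < 57")
      case True
      show ?thesis by (rule two) (use E n35 True in linarith)+
    next
      case False
      show ?thesis by (rule sieve_ok_mediumI) (use E n35 q False in linarith)+
    qed
  next
    case 2
    show ?thesis by (rule sieve_ok_mediumI) (use 2 n in auto)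
  next
    case 3
    have E: "4 * n \<le> 11 * E" and n44: "44 \<le> n" using 3 n by auto
    show ?thesis
    proof (cases "q = 2 \<and> n < 57")
      case True
      show ?thesis by (rule two) (use E n44 True in linarith)+
    next
      case False
      show ?thesis by (rule sieve_ok_mediumI) (use E n44 q False in linarith)+
    qed
  next
    case 4
    show ?thesis by (rule sieve_ok_mediumI) (use 4 n in auto)
  next
    case 5
    show ?thesis
      by (rule sieve_ok_exp[OF 5(3), of 564 n 12 5 1])
        (use 5 n exp_6_7_ge huge_condition(2) in auto)
  next
    case 6
    have E: "34 * n \<le> 114 * E" and n114: "114 \<le> n" using 6 n by auto
    show ?thesis by (rule sieve_ok_mediumI) (use E n114 q in linarith)+
  next
    case 7
    have E: "1 * n \<le> 15 * E" and n15: "15 \<le> n" using 7 n by auto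
    define m where "m = (2::nat) ^ 34"
    have m: "real m \<le> exp 26.1" "m > 0" using exp_26_1_ge by (auto simp: m_def)
    have "(34 - 1) * 2 ^ (34 - 2) \<le> m * 15" by (simp add: m_def)
    also have "\<dots> \<le> m * n" using n15 by (rule mult_le_mono2)
    finally have "(34 - 1) * 2 ^ (34 - 2) \<le> m * n" .
    from sieve_ok_exp[OF 7(3) m(1) _ _ this _ E m(2) huge_condition(3)] n15 show ?thesis by simp
  qed
qed

theorem theorem5p1:
  fixes q n k :: nat and d :: "nat \<Rightarrow> nat" and a :: "nat \<Rightarrow> 'a::finite_field"
  assumes "primepow q"
    and "n > 1" and "\<not> primepow n"
    and "card (UNIV :: 'a set) = q ^ n"
    and "1 < k" and "k < card {t. t dvd n}"
    and "d \<in> Lambda k n"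
    and "\<forall>i\<in>{1..k}. \<forall>j\<in>{1..k}. i < j \<longrightarrow> gcd (d i) (d j) = 1"
    and "a \<in> F_prod q k d"
    and "admissible q k d a"
    and "k \<ge> 3 \<or>
         (k = 2 \<and>
           ((d 1 \<ge> 5 \<and> ((d 1, d 2) = (5, 6) \<longrightarrow> q \<ge> 5)) \<or>
            (d 1 = 4 \<and> (d 2 \<ge> 11 \<or> (d 2 \<ge> 9 \<and> q \<ge> 3) \<or>
                        (d 2 \<in> {5, 7} \<and> real q \<ge> exp (exp 6.7)))) \<or>
            (d 1 = 3 \<and> (d 2 \<ge> 38 \<or> (d 2 \<ge> 5 \<and> real q \<ge> exp (exp 26.1))))))"
  shows "\<exists>\<alpha>::'a. primitive_element \<alpha> \<and> (\<forall>i\<in>{1..k}. Trace q n (d i) \<alpha> = a i)"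
proof -
  let ?I = "{1..k}"
  note q = assms(1) and card = assms(4) and k = assms(5)
  have n: "n > 0" using assms(2) by simp
  have q2: "q \<ge> 2" using primepow_gt_Suc_0[OF q] by simp
  have dvd: "d i dvd n" if "i \<in> ?I" for i using assms(7) that by (auto simp: Lambda_def PiE_def)
  have mono: "d i < d j" if "i \<in> ?I" "j \<in> ?I" "i < j" for i j
    using assms(7) that by (auto simp: Lambda_def strict_mono_on_def)
  have ndvd: "\<not> d i dvd d j" if "i \<in> ?I" "j \<in> ?I" "i \<noteq> j" for i j
    using assms(7) that by (auto simp: Lambda_def)
  have gcd1: "gcd (d i) (d j) = 1" if "i \<in> ?I" "j \<in> ?I" "i \<noteq> j" for i j
    using assms(8) that by (metis gcd.commute linorder_neqE_nat)
  hence cop: "coprime (d i) (d j)" if "i \<in> ?I" "j \<in> ?I" "i \<noteq> j" for i j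
    using that by (simp add: coprime_iff_gcd_eq_1)
  have d2: "d i \<ge> 2" if "i \<in> ?I" for i
  proof -
    \<comment> \<open>A second index exists because \<open>k > 1\<close>; were \<open>d i\<close>
      equal to 1, it would divide the other divisor.\<close>
    have "\<exists>j\<in>?I. j \<noteq> i" using k by (intro bexI[of _ "if i = 1 then 2 else 1"]) auto
    then obtain j where "j \<in> ?I" "j \<noteq> i" by blast
    hence "d i \<noteq> 1" using ndvd[OF that, of j] by auto
    moreover have "d i \<noteq> 0" using dvd[OF that] n by (auto intro: notI)
    ultimately show ?thesis by simp
  qed
  have a: "a i ^ (q ^ d i) = a i" if "i \<in> ?I" for i
  proof -
    have "a i \<in> GF_sub (q ^ d i)" using assms(9) that by (auto simp: F_prod_def PiE_def)
    thus ?thesis using GF_sub_eq[OF card q n dvd[OF that]] by simp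
  qed
  have adm: "Trace q (d i) 1 (a i) = Trace q (d j) 1 (a j)" if "i \<in> ?I" "j \<in> ?I" "i \<noteq> j" for i j
    using assms(10) that gcd1 unfolding admissible_def by (metis linorder_neqE_nat)
  define l where "l = 1 + (\<Sum>i\<in>?I. d i - 1)"
  have prod_le: "(\<Prod>i\<in>?I. d i) \<le> n"
    using prod_coprime_dvd[of ?I d n] cop dvd n by (intro dvd_imp_le) auto
  have ok: "n = n - 2 * l + 2 * l \<and> sieve_ok (q ^ n - 1) (sqrt (real (q ^ (n - 2 * l))))"
  proof (cases "k \<ge> 3")
    case True
    have I3: "1 \<in> ?I" "2 \<in> ?I" "3 \<in> ?I" using True by auto
    have "d 1 < d 2" "d 2 < d 3" using I3 by (auto intro: mono)
    \<comment> \<open>This excludes (2,3,4), the only increasing triple starting at 2 or more whose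
      third entry is below 5.\<close>
    moreover have "\<not> (d 1 = 2 \<and> d 3 = 4)" using ndvd[OF I3(1,3)] by auto
    ultimately have b: "2 \<le> d 1" "3 \<le> d 2" "5 \<le> d 3" using d2[OF I3(1)] by auto
    have sub: "{1, 2, 3} \<subseteq> ?I" using I3 by auto
    have "15 * (1 + (\<Sum>i\<in>{1, 2, 3}. d i - 1)) \<le> 4 * (\<Prod>i\<in>{1, 2, 3}. d i)"
      using lambda_bound_three[OF b] by (simp add: mult_ac add_ac)
    hence "15 * l \<le> 4 * (\<Prod>i\<in>?I. d i)"
      unfolding l_def using d2 by (intro lambda_bound_extend[OF _ sub]) force+
    hence l: "15 * l \<le> 4 * n" using prod_le by linarith
    have "(\<Sum>i\<in>{1, 2, 3}. d i - 1) \<le> (\<Sum>i\<in>?I. d i - 1)" by (rule sum_mono2[OF _ sub]) auto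
    moreover have "7 \<le> (\<Sum>i\<in>{1, 2, 3}. d i - 1)" using b by simp
    ultimately have l8: "8 \<le> l" unfolding l_def by linarith
    have nl: "n = n - 2 * l + 2 * l" using l by simp
    show ?thesis using sieve_ok_three_or_more[OF q2 nl l l8] nl by blast
  next
    case False
    hence k2: "k = 2" using k by simp
    have I2: "?I = {1, 2}" unfolding k2 by auto
    have xy: "d 1 < d 2" by (rule mono) (auto simp: k2)
    have "2 \<le> d 1" by (rule d2) (simp add: k2)
    hence l: "l = d 1 + d 2 - 1" using xy unfolding l_def I2 by simp
    have le: "d 1 * d 2 \<le> n" using prod_le unfolding I2 by simp
    have cases: "(d 1 \<ge> 5 \<and> ((d 1, d 2) = (5, 6) \<longrightarrow> q \<ge> 5)) \<or>
      (d 1 = 4 \<and> (d 2 \<ge> 11 \<or> (d 2 \<ge> 9 \<and> q \<ge> 3) \<or> (d 2 \<in> {5, 7} \<and> real q \<ge> exp (exp 6.7)))) \<or>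
      (d 1 = 3 \<and> (d 2 \<ge> 38 \<or> (d 2 \<ge> 5 \<and> real q \<ge> exp (exp 26.1))))"
      using assms(11) False by blast
    have "d 1 \<ge> 3" "d 2 \<ge> 5" using cases xy by auto
    then obtain e f where "d 1 = 3 + e" "d 2 = 5 + f" by (metis le_Suc_ex)
    \<comment> \<open>Ensures \<open>2 * l \<le> n\<close>, so that the truncated difference
      \<open>n - 2 * l\<close> is the true one.\<close>
    hence "2 * (d 1 + d 2 - 1) \<le> d 1 * d 2" by (simp add: algebra_simps)
    hence nl: "n = n - 2 * l + 2 * (d 1 + d 2 - 1)" using le l by simp
    show ?thesis using sieve_ok_two_divisors[OF q2 nl le xy cases] nl l by simp
  qed
  hence nl: "n = n - 2 * l + 2 * l" and ok: "sieve_ok (q ^ n - 1) (sqrt (real (q ^ (n - 2 * l))))" by auto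
  show ?thesis
    by (rule primitive_element_with_traces[OF q card n _ _ dvd cop a adm nl[unfolded l_def] ok[unfolded l_def]])
      (use k in auto)
qed

end
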